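(* Let $B$ be a central subgroup of a group $G$. Then there is a natural isomorphism of abelian groups $\alpha\colon Q(G,B)^{ab}\xrightarrow{\cong}P_2(G,B)$ such that $\alpha\circ ab\circ q=p_2$ and $\alpha\circ ab\circ w_q=\mu_2$.
   Context: For a function $f\colon G\to H$ between groups, with the target written additively (though not necessarily abelian), put $d_f(a,b)=f(ab)-f(b)-f(a)$. The map $f$ is quadratic if $d_f$ is bilinear and $d_f(a,b)$ commutes with $f(c)$ for all $a,b,c\in G$; for a subgroup $B\le G$ it is quadratic relative $B$ if moreover $d_f(B\times G)=d_f(G\times B)=0$, and then $w_f\colon G/BG'\otimes G/BG'\to H$ is the homomorphism with $w_f(\bar a\otimes\bar b)=d_f(a,b)$ ($G'=[G,G]$). The map $q\colon G\to Q(G,B)$ is the universal quadratic map relative $B$: $q$ is quadratic relative $B$ and every $f\colon G\to H$ quadratic relative $B$ factors as $f=\hat f q$ for a unique homomorphism $\hat f\colon Q(G,B)\to H$. (Concretely, $Q(G,B)=(G/BG'\otimes G/BG')\times G$ as a set, with group law $(x,a)+(y,b)=(x+y-\bar a\otimes\bar b,\,ab)$, and $q(a)=(0,a)$, $w_q(x)=(x,1)$.) For a group $K$, $ab\colon K\to K^{ab}=K/[K,K]$ is the quotient map. $I(G)$ is the augmentation ideal of the integral group ring $\mathbb{Z}(G)$, $I^k(G)$ its $k$-th power, $I(B)$ the augmentation ideal of $\mathbb{Z}(B)$. $P_2(G,B)=I(G)/(I(B)I(G)+I^3(G))$, a ring without unit, with quotient map $\rho$; $p_2\colon G\to P_2(G,B)$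 is $p_2(a)=\rho(a-1)$. For $B$ central, $\mu_2\colon G/BG'\otimes G/BG'\to P_2(G,B)$ is the homomorphism with $\mu_2(\bar a\otimes\bar b)=p_2(a)p_2(b)$ for $a,b\in G$. Natural means natural with respect to homomorphisms $f\colon G\to H$ with $f(B)\subset C$, for pairs $(G,B)$, $(H,C)$ of groups with central subgroups. *)

theory Defs
  imports
    "HOL-Algebra.Generated_Groups"
    "HOL-Algebra.Free_Abelian_Groups"
    "HOL-Algebra.QuotRing"
    "HOL-Algebra.Ideal_Product"
begin

section \<open>Pairs of a group and a central subgroup\<close>

definition central_pair :: "('a, 'm) monoid_scheme \<Rightarrow> 'a set \<Rightarrow> bool" where
  "central_pair G B \<longleftrightarrow> group G \<and> subgroup B G \<and>
     (\<forall>b\<in>B. \<forall>g\<in>carrier G. b \<otimes>\<^bsub>G\<^esub> g = g \<otimes>\<^bsub>G\<^esub> b)"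

definition pair_hom ::
  "('a, 'm) monoid_scheme \<Rightarrow> 'a set \<Rightarrow> ('b, 'n) monoid_scheme \<Rightarrow> 'b set \<Rightarrow> ('a \<Rightarrow> 'b) set" where
  "pair_hom G B H C = {f \<in> hom G H. f ` B \<subseteq> C}"


section \<open>Quotients, abelianization, tensor products\<close>

text \<open>
  The homomorphism \<open>G/N \<rightarrow> H/M\<close> induced by a homomorphism \<open>f : G \<rightarrow> H\<close> with \<open>f(N) \<subseteq> M\<close>:
  for a coset \<open>X = Nx\<close> the set product \<open>M f(X)\<close> is the coset \<open>M f(x)\<close>.
\<close>

definition induced_map :: "('b, 'n) monoid_scheme \<Rightarrow> 'b set \<Rightarrow> ('a \<Rightarrow> 'b) \<Rightarrow> 'a set \<Rightarrow> 'b set" where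
  "induced_map H M f X = M <#>\<^bsub>H\<^esub> (f ` X)"

definition abelianization :: "('a, 'm) monoid_scheme \<Rightarrow> 'a set monoid" where
  "abelianization K = K Mod derived K (carrier K)"

definition ab :: "('a, 'm) monoid_scheme \<Rightarrow> 'a \<Rightarrow> 'a set" where
  "ab K x = derived K (carrier K) #>\<^bsub>K\<^esub> x"

type_synonym ('a, 'b) tensor = "('a \<times> 'b \<Rightarrow>\<^sub>0 int) set"

text \<open>
  The tensor product over the integers of two commutative groups, both of them and the result
  in multiplicative notation: the free abelian group on pairs modulo the bilinearity relations.
\<close>

definition tensor_relations ::
  "('a, 'm) monoid_scheme \<Rightarrow> ('b, 'n) monoid_scheme \<Rightarrow> ('a \<times> 'b \<Rightarrow>\<^sub>0 int) set" where
  "tensor_relations A B =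
     {frag_of (x \<otimes>\<^bsub>A\<^esub> x', y) - frag_of (x, y) - frag_of (x', y) | x x' y.
        x \<in> carrier A \<and> x' \<in> carrier A \<and> y \<in> carrier B} \<union>
     {frag_of (x, y \<otimes>\<^bsub>B\<^esub> y') - frag_of (x, y) - frag_of (x, y') | x y y'.
        x \<in> carrier A \<and> y \<in> carrier B \<and> y' \<in> carrier B}"

definition tensor_kernel ::
  "('a, 'm) monoid_scheme \<Rightarrow> ('b, 'n) monoid_scheme \<Rightarrow> ('a \<times> 'b \<Rightarrow>\<^sub>0 int) set" where
  "tensor_kernel A B =
     generate (free_Abelian_group (carrier A \<times> carrier B)) (tensor_relations A B)"

definition tensor_group ::
  "('a, 'm) monoid_scheme \<Rightarrow> ('b, 'n) monoid_scheme \<Rightarrow> ('a, 'b) tensor monoid" where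
  "tensor_group A B = free_Abelian_group (carrier A \<times> carrier B) Mod tensor_kernel A B"

definition tensor_elem ::
  "('a, 'm) monoid_scheme \<Rightarrow> ('b, 'n) monoid_scheme \<Rightarrow> 'a \<Rightarrow> 'b \<Rightarrow> ('a, 'b) tensor" where
  "tensor_elem A B x y =
     tensor_kernel A B #>\<^bsub>free_Abelian_group (carrier A \<times> carrier B)\<^esub> frag_of (x, y)"

text \<open>The map \<open>g \<otimes> h\<close> into the tensor product of the groups \<open>C\<close> and \<open>D\<close>.\<close>

definition tensor_map ::
  "('c, 'm) monoid_scheme \<Rightarrow> ('d, 'n) monoid_scheme \<Rightarrow> ('a \<Rightarrow> 'c) \<Rightarrow> ('b \<Rightarrow> 'd) \<Rightarrow>
   ('a, 'b) tensor \<Rightarrow> ('c, 'd) tensor" where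
  "tensor_map C D g h =
     induced_map (free_Abelian_group (carrier C \<times> carrier D)) (tensor_kernel C D)
       (frag_extend (\<lambda>(x, y). frag_of (g x, h y)))"


section \<open>The universal quadratic map\<close>

definition BG' :: "('a, 'm) monoid_scheme \<Rightarrow> 'a set \<Rightarrow> 'a set" where
  "BG' G B = B <#>\<^bsub>G\<^esub> derived G (carrier G)"

definition bar_group :: "('a, 'm) monoid_scheme \<Rightarrow> 'a set \<Rightarrow> 'a set monoid" where
  "bar_group G B = G Mod BG' G B"

definition bar :: "('a, 'm) monoid_scheme \<Rightarrow> 'a set \<Rightarrow> 'a \<Rightarrow> 'a set" where
  "bar G B a = BG' G B #>\<^bsub>G\<^esub> a"

abbreviation bar_tensor_group ::
  "('a, 'm) monoid_scheme \<Rightarrow> 'a set \<Rightarrow> ('a set, 'a set) tensor monoid" where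
  "bar_tensor_group G B \<equiv> tensor_group (bar_group G B) (bar_group G B)"

definition bar_tensor ::
  "('a, 'm) monoid_scheme \<Rightarrow> 'a set \<Rightarrow> 'a \<Rightarrow> 'a \<Rightarrow> ('a set, 'a set) tensor" where
  "bar_tensor G B a b = tensor_elem (bar_group G B) (bar_group G B) (bar G B a) (bar G B b)"

text \<open>
  The universal quadratic map \<open>q : G \<rightarrow> Q(G,B)\<close> relative \<open>B\<close> in its concrete form. In additive
  notation for \<open>Q(G,B)\<close> and the tensor product, the group law is
  \<open>(x,a) + (y,b) = (x + y - bar a \<otimes> bar b, ab)\<close>; with it
  \<open>q(ab) - q(b) - q(a) = w_q(bar a \<otimes> bar b)\<close>.
\<close>

type_synonym 'a quad = "('a set, 'a set) tensor \<times> 'a"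

definition Q :: "('a, 'm) monoid_scheme \<Rightarrow> 'a set \<Rightarrow> 'a quad monoid" where
  "Q G B =
     \<lparr>carrier = carrier (bar_tensor_group G B) \<times> carrier G,
      monoid.mult = (\<lambda>(x, a) (y, b).
        (x \<otimes>\<^bsub>bar_tensor_group G B\<^esub> y
           \<otimes>\<^bsub>bar_tensor_group G B\<^esub> inv\<^bsub>bar_tensor_group G B\<^esub> bar_tensor G B a b,
         a \<otimes>\<^bsub>G\<^esub> b)),
      one = (\<one>\<^bsub>bar_tensor_group G B\<^esub>, \<one>\<^bsub>G\<^esub>)\<rparr>"

definition q :: "('a, 'm) monoid_scheme \<Rightarrow> 'a set \<Rightarrow> 'a \<Rightarrow> 'a quad" where
  "q G B a = (\<one>\<^bsub>bar_tensor_group G B\<^esub>, a)"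

definition w_q :: "('a, 'm) monoid_scheme \<Rightarrow> 'a set \<Rightarrow> ('a set, 'a set) tensor \<Rightarrow> 'a quad" where
  "w_q G B x = (x, \<one>\<^bsub>G\<^esub>)"

text \<open>
  The homomorphism \<open>Q(G,B) \<rightarrow> Q(H,C)\<close> induced by \<open>f\<close>, i.e. the one taking \<open>q(a)\<close> to \<open>q(f(a))\<close>,
  and its abelianization.
\<close>

definition Q_map ::
  "('b, 'n) monoid_scheme \<Rightarrow> 'b set \<Rightarrow> ('a \<Rightarrow> 'b) \<Rightarrow> 'a quad \<Rightarrow> 'b quad" where
  "Q_map H C f = (\<lambda>(x, a).
     (tensor_map (bar_group H C) (bar_group H C)
        (induced_map H (BG' H C) f) (induced_map H (BG' H C) f) x,
      f a))"

definition Qab_map ::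
  "('b, 'n) monoid_scheme \<Rightarrow> 'b set \<Rightarrow> ('a \<Rightarrow> 'b) \<Rightarrow> 'a quad set \<Rightarrow> 'b quad set" where
  "Qab_map H C f = induced_map (Q H C) (derived (Q H C) (carrier (Q H C))) (Q_map H C f)"


section \<open>The integral group ring and the quotient of the augmentation ideal\<close>

text \<open>\<^const>\<open>frag_extend\<close> is integer-linear extension, so the product is the bilinear
  extension of the product of \<open>G\<close>.\<close>

definition group_ring :: "('a, 'm) monoid_scheme \<Rightarrow> ('a \<Rightarrow>\<^sub>0 int) ring" where
  "group_ring G =
     \<lparr>carrier = {c. Poly_Mapping.keys c \<subseteq> carrier G},
      monoid.mult = (\<lambda>c d. frag_extend (\<lambda>x. frag_extend (\<lambda>y. frag_of (x \<otimes>\<^bsub>G\<^esub> y)) d) c),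
      one = frag_of \<one>\<^bsub>G\<^esub>,
      zero = 0,
      add = (+)\<rparr>"

definition augmentation :: "('a \<Rightarrow>\<^sub>0 int) \<Rightarrow> int" where
  "augmentation c = (\<Sum>x\<in>Poly_Mapping.keys c. Poly_Mapping.lookup c x)"

definition aug_ideal :: "('a, 'm) monoid_scheme \<Rightarrow> ('a \<Rightarrow>\<^sub>0 int) set" where
  "aug_ideal G = {c \<in> carrier (group_ring G). augmentation c = 0}"

text \<open>
  \<open>I(B)I(G) + I\<^sup>3(G)\<close>, where the augmentation ideal of the group ring of \<open>B\<close> is regarded as a
  subset of the group ring of \<open>G\<close>; \<^const>\<open>ideal_prod\<close> consists of all finite sums of products,
  also when its first argument is not an ideal of the ambient ring.
\<close>

definition P2_ideal :: "('a, 'm) monoid_scheme \<Rightarrow> 'a set \<Rightarrow> ('a \<Rightarrow>\<^sub>0 int) set" where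
  "P2_ideal G B =
     ideal_prod (group_ring G) (aug_ideal (G\<lparr>carrier := B\<rparr>)) (aug_ideal G)
     <+>\<^bsub>group_ring G\<^esub>
     ideal_prod (group_ring G) (ideal_prod (group_ring G) (aug_ideal G) (aug_ideal G)) (aug_ideal G)"

text \<open>
  \<open>P\<^sub>2(G,B)\<close> is a ring without unit: the \<^const>\<open>one\<close> field of this record carries no meaning and
  lies outside the carrier in general.
\<close>

definition P2 :: "('a, 'm) monoid_scheme \<Rightarrow> 'a set \<Rightarrow> ('a \<Rightarrow>\<^sub>0 int) set ring" where
  "P2 G B = (group_ring G)\<lparr>carrier := aug_ideal G\<rparr> Quot P2_ideal G B"

definition rho :: "('a, 'm) monoid_scheme \<Rightarrow> 'a set \<Rightarrow> ('a \<Rightarrow>\<^sub>0 int) \<Rightarrow> ('a \<Rightarrow>\<^sub>0 int) set" where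
  "rho G B c = P2_ideal G B +>\<^bsub>group_ring G\<^esub> c"

definition p2 :: "('a, 'm) monoid_scheme \<Rightarrow> 'a set \<Rightarrow> 'a \<Rightarrow> ('a \<Rightarrow>\<^sub>0 int) set" where
  "p2 G B a = rho G B (frag_of a - frag_of \<one>\<^bsub>G\<^esub>)"

definition mu2 ::
  "('a, 'm) monoid_scheme \<Rightarrow> 'a set \<Rightarrow> ('a set, 'a set) tensor \<Rightarrow> ('a \<Rightarrow>\<^sub>0 int) set" where
  "mu2 G B =
     (THE h. h \<in> hom (bar_tensor_group G B) (add_monoid (P2 G B)) \<and>
             h \<in> extensional (carrier (bar_tensor_group G B)) \<and>
             (\<forall>a\<in>carrier G. \<forall>b\<in>carrier G.
                h (bar_tensor G B a b) = p2 G B a \<otimes>\<^bsub>P2 G B\<^esub> p2 G B b))"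

text \<open>The homomorphism \<open>P\<^sub>2(G,B) \<rightarrow> P\<^sub>2(H,C)\<close> induced by the ring homomorphism extending \<open>f\<close>.\<close>

definition P2_map ::
  "('b, 'n) monoid_scheme \<Rightarrow> 'b set \<Rightarrow> ('a \<Rightarrow> 'b) \<Rightarrow> ('a \<Rightarrow>\<^sub>0 int) set \<Rightarrow> ('b \<Rightarrow>\<^sub>0 int) set" where
  "P2_map H C f = induced_map (add_monoid (group_ring H)) (P2_ideal H C) (frag_extend (frag_of \<circ> f))"


section \<open>Natural families\<close>

type_synonym 'a QP_family = "'a monoid \<Rightarrow> 'a set \<Rightarrow> 'a quad set \<Rightarrow> ('a \<Rightarrow>\<^sub>0 int) set"

text \<open>
  A family cannot range over groups of all types at once. It is therefore given by one component for
  each of two arbitrary carrier types, and naturality refers to the homomorphisms from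
  pairs over the type of the first argument to pairs over the type of the second one.
\<close>

definition natural_between :: "'a QP_family \<Rightarrow> 'b QP_family \<Rightarrow> bool" where
  "natural_between \<alpha> \<beta> \<longleftrightarrow>
     (\<forall>G B H C. central_pair G B \<longrightarrow> central_pair H C \<longrightarrow>
        (\<forall>f\<in>pair_hom G B H C. \<forall>X\<in>carrier (abelianization (Q G B)).
           \<beta> H C (Qab_map H C f X) = P2_map H C f (\<alpha> G B X)))"

end

theory Submission
  imports Defs "HOL-Algebra.Zassenhaus"
begin

text \<open>
  The maps \<open>ab \<circ> q\<close> and \<open>p\<^sub>2\<close> are both universal among the maps from \<open>G\<close> to abelian groups that are
  quadratic relative \<open>B\<close>, which is why their targets are isomorphic.

  In one direction, \<open>p\<^sub>2(ab) = p\<^sub>2(a) + p\<^sub>2(b) + p\<^sub>2(a) p\<^sub>2(b)\<close>. The product \<open>p\<^sub>2(a) p\<^sub>2(b)\<close> is bilinear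
  modulo \<open>I\<^sup>3(G)\<close>, and it vanishes if \<open>a\<close> or \<open>b\<close> lies in \<open>B\<close>, modulo \<open>I(B)I(G)\<close> and because \<open>B\<close> is
  central. Hence \<open>\<mu>\<^sub>2\<close> exists, and \<open>(x, a) \<mapsto> \<mu>\<^sub>2(x) + p\<^sub>2(a)\<close> is a homomorphism
  \<open>Q(G,B) \<rightarrow> P\<^sub>2(G,B)\<close> (\<open>Q_to_P2_hom\<close>). It is surjective since the values of \<open>p\<^sub>2\<close> generate
  \<open>P\<^sub>2(G,B)\<close> (\<open>P_generated\<close>).

  In the other direction, the linear extension of \<open>ab \<circ> q\<close> to the group ring takes
  \<open>(a - 1)(b - 1)\<close> to \<open>ab(w_q(a \<otimes> b))\<close>, so it kills \<open>I(B)I(G)\<close> and, by bilinearity of the tensor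
  product, also \<open>I\<^sup>3(G)\<close>. This gives a homomorphism \<open>P\<^sub>2(G,B) \<rightarrow> Q(G,B)\<^sup>a\<^sup>b\<close> with
  \<open>p\<^sub>2(a) \<mapsto> ab(q(a))\<close> (\<open>P2_universal\<close>, \<open>P2_to_Qab\<close>). Since \<open>Q(G,B)\<close> is generated by the values of \<open>q\<close>
  (\<open>hom_Q_eqI\<close>), its composite with the map above is \<open>ab\<close>; therefore the kernel of that map is the
  commutator subgroup (\<open>kernel_Q_to_P2\<close>), and the induced map \<open>Q(G,B)\<^sup>a\<^sup>b \<rightarrow> P\<^sub>2(G,B)\<close> is an isomorphism.

  For naturality, too, it suffices to compare two homomorphisms on the values of \<open>q\<close>.
\<close>

section \<open>Homomorphisms on quotients and on free abelian groups\<close>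

lemma induced_map_coset:
  assumes "group_hom G H f" "N \<lhd> G" "M \<lhd> H" "f ` N \<subseteq> M" "x \<in> carrier G"
  shows "induced_map H M f (N #>\<^bsub>G\<^esub> x) = M #>\<^bsub>H\<^esub> f x"
proof -
  interpret group_hom G H f by fact
  interpret N: normal N G by fact
  interpret M: normal M H by fact
  have eq: "m \<otimes>\<^bsub>H\<^esub> f (n \<otimes>\<^bsub>G\<^esub> x) = (m \<otimes>\<^bsub>H\<^esub> f n) \<otimes>\<^bsub>H\<^esub> f x" "m \<otimes>\<^bsub>H\<^esub> f n \<in> M"
    if "m \<in> M" "n \<in> N" for m n
  proof -
    have "f n \<in> M" using assms(4) that by blast
    then show "m \<otimes>\<^bsub>H\<^esub> f (n \<otimes>\<^bsub>G\<^esub> x) = (m \<otimes>\<^bsub>H\<^esub> f n) \<otimes>\<^bsub>H\<^esub> f x" "m \<otimes>\<^bsub>H\<^esub> f n \<in> M"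
      using that assms(5) by (auto simp: H.m_assoc)
  qed
  have "M <#>\<^bsub>H\<^esub> (f ` (N #>\<^bsub>G\<^esub> x)) \<subseteq> M #>\<^bsub>H\<^esub> f x"
    using eq by (fastforce simp: set_mult_def r_coset_def)
  moreover have "m \<otimes>\<^bsub>H\<^esub> f x \<in> M <#>\<^bsub>H\<^esub> (f ` (N #>\<^bsub>G\<^esub> x))" if "m \<in> M" for m
    using that assms(5) G.rcos_self[OF assms(5) N.subgroup_axioms] by (auto simp: set_mult_def)
  ultimately show ?thesis
    by (auto simp: induced_map_def r_coset_def)
qed

lemma induced_map_hom:
  assumes "group_hom G H f" "N \<lhd> G" "M \<lhd> H" "f ` N \<subseteq> M"
  shows "induced_map H M f \<in> hom (G Mod N) (H Mod M)"
proof -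
  interpret group_hom G H f by fact
  interpret N: normal N G by fact
  interpret M: normal M H by fact
  show ?thesis
    by (auto simp: hom_def carrier_FactGroup induced_map_coset[OF assms] N.rcos_sum M.rcos_sum)
qed

lemma hom_free_Abelian_group_diff:
  assumes "h \<in> hom (free_Abelian_group S) K" "group K"
    and "Poly_Mapping.keys c \<subseteq> S" "Poly_Mapping.keys d \<subseteq> S"
  shows "h (c - d) = h c \<otimes>\<^bsub>K\<^esub> inv\<^bsub>K\<^esub> h d"
proof -
  interpret h: group_hom "free_Abelian_group S" K h
    using assms by (simp add: group_hom_def group_hom_axioms_def)
  show ?thesis
    using h.hom_mult[of c "-d"] h.hom_inv[of d] assms by simp
qed

lemma hom_free_Abelian_group_eqI:
  assumes "h \<in> hom (free_Abelian_group S) K" "h' \<in> hom (free_Abelian_group S) K" "group K"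
    and "\<And>s. s \<in> S \<Longrightarrow> h (frag_of s) = h' (frag_of s)"
    and "Poly_Mapping.keys c \<subseteq> S"
  shows "h c = h' c"
proof -
  interpret h: group_hom "free_Abelian_group S" K h
    using assms by (simp add: group_hom_def group_hom_axioms_def)
  interpret h': group_hom "free_Abelian_group S" K h'
    using assms by (simp add: group_hom_def group_hom_axioms_def)
  show ?thesis
  proof (rule free_Abelian_group_induct[OF assms(5), of "\<lambda>c. h c = h' c"])
    show "h (x - y) = h' (x - y)"
      if "Poly_Mapping.keys x \<subseteq> S" "Poly_Mapping.keys y \<subseteq> S" "h x = h' x" "h y = h' y" for x y
      using that by (simp add: hom_free_Abelian_group_diff[OF assms(1,3)] hom_free_Abelian_group_diff[OF assms(2,3)])
  qed (use assms(4) h.hom_one h'.hom_one in auto)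
qed

text \<open>
  A homomorphism into any group factors through the quotient by the subgroup generated by
  \<open>S\<close> as soon as it is trivial on \<open>S\<close>, if that subgroup is normal.
\<close>

lemma (in group_hom) FactGroup_universal_generate:
  assumes "generate G S \<lhd> G" and "S \<subseteq> carrier G" and "\<And>s. s \<in> S \<Longrightarrow> h s = \<one>\<^bsub>H\<^esub>"
  obtains g where "g \<in> hom (G Mod generate G S) H"
    and "\<And>x. x \<in> carrier G \<Longrightarrow> g (generate G S #>\<^bsub>G\<^esub> x) = h x"
proof -
  have "generate G S \<subseteq> kernel G H h"
    using assms by (intro G.generate_subgroup_incl subgroup_kernel) (auto simp: kernel_def)
  then show thesis
    using FactGroup_universal_kernel[OF assms(1)] that by blast
qed

section \<open>Tensor products\<close>

context
  fixes A :: "('a, 'm) monoid_scheme" and B :: "('b, 'n) monoid_scheme"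
  assumes A: "group A" and B: "group B"
begin

interpretation A: group A by (rule A)
interpretation B: group B by (rule B)

abbreviation (input) "free_on_pairs \<equiv> free_Abelian_group (carrier A \<times> carrier B)"

lemma tensor_relations_carrier: "tensor_relations A B \<subseteq> carrier free_on_pairs"
  unfolding tensor_relations_def
  by (auto dest!: subsetD[OF keys_diff])

lemma tensor_kernel_subgroup: "subgroup (tensor_kernel A B) free_on_pairs"
  unfolding tensor_kernel_def
  by (rule group.generate_is_subgroup[OF group_free_Abelian_group tensor_relations_carrier])

lemma tensor_kernel_normal: "tensor_kernel A B \<lhd> free_on_pairs"
  using tensor_kernel_subgroup comm_group.normal_iff_subgroup[OF abelian_free_Abelian_group] by blast

lemma comm_group_tensor_group: "comm_group (tensor_group A B)"
  unfolding tensor_group_def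
  by (rule comm_group.abelian_FactGroup[OF abelian_free_Abelian_group tensor_kernel_subgroup])

lemma tensor_coset_hom: "(\<lambda>c. tensor_kernel A B #>\<^bsub>free_on_pairs\<^esub> c) \<in> hom free_on_pairs (tensor_group A B)"
  unfolding tensor_group_def by (rule normal.r_coset_hom_Mod[OF tensor_kernel_normal])

lemma tensor_elem_closed:
  "x \<in> carrier A \<Longrightarrow> y \<in> carrier B \<Longrightarrow> tensor_elem A B x y \<in> carrier (tensor_group A B)"
  using hom_in_carrier[OF tensor_coset_hom, of "frag_of (x, y)"] by (simp add: tensor_elem_def)

lemma tensor_relation_coset:
  assumes "frag_of u - frag_of v - frag_of w \<in> tensor_relations A B"
    and "u \<in> carrier A \<times> carrier B" "v \<in> carrier A \<times> carrier B" "w \<in> carrier A \<times> carrier B"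
  shows "tensor_kernel A B #>\<^bsub>free_on_pairs\<^esub> frag_of u =
    (tensor_kernel A B #>\<^bsub>free_on_pairs\<^esub> frag_of v) \<otimes>\<^bsub>tensor_group A B\<^esub> (tensor_kernel A B #>\<^bsub>free_on_pairs\<^esub> frag_of w)"
proof -
  interpret F: group free_on_pairs by simp
  have "frag_of u - (frag_of v + frag_of w) \<in> tensor_kernel A B"
    using assms(1) by (simp add: tensor_kernel_def generate.incl diff_diff_eq)
  then have "frag_of u \<in> tensor_kernel A B #>\<^bsub>free_on_pairs\<^esub> (frag_of v + frag_of w)"
    by (force simp: r_coset_def)
  then have "tensor_kernel A B #>\<^bsub>free_on_pairs\<^esub> (frag_of v + frag_of w) = tensor_kernel A B #>\<^bsub>free_on_pairs\<^esub> frag_of u"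
    using F.repr_independence[OF _ _ tensor_kernel_subgroup] assms(3,4)
    by (metis F.m_closed frag_of_in_free_Abelian_group mult_free_Abelian_group)
  then show ?thesis
    using hom_mult[OF tensor_coset_hom, of "frag_of v" "frag_of w"] assms(3,4) by simp
qed

lemma tensor_elem_mult_left:
  assumes "x \<in> carrier A" "x' \<in> carrier A" "y \<in> carrier B"
  shows "tensor_elem A B (x \<otimes>\<^bsub>A\<^esub> x') y =
    tensor_elem A B x y \<otimes>\<^bsub>tensor_group A B\<^esub> tensor_elem A B x' y"
  unfolding tensor_elem_def
  by (rule tensor_relation_coset) (use assms in \<open>auto simp: tensor_relations_def\<close>)

lemma tensor_elem_mult_right:
  assumes "x \<in> carrier A" "y \<in> carrier B" "y' \<in> carrier B"
  shows "tensor_elem A B x (y \<otimes>\<^bsub>B\<^esub> y') =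
    tensor_elem A B x y \<otimes>\<^bsub>tensor_group A B\<^esub> tensor_elem A B x y'"
  unfolding tensor_elem_def
  by (rule tensor_relation_coset) (use assms in \<open>auto simp: tensor_relations_def\<close>)

text \<open>
  The elementary tensors generate the tensor product.
\<close>

lemma hom_tensor_group_eqI:
  assumes "h \<in> hom (tensor_group A B) K" "h' \<in> hom (tensor_group A B) K" "group K"
    and "\<And>x y. x \<in> carrier A \<Longrightarrow> y \<in> carrier B \<Longrightarrow> h (tensor_elem A B x y) = h' (tensor_elem A B x y)"
    and "t \<in> carrier (tensor_group A B)"
  shows "h t = h' t"
proof -
  from assms(5) obtain c where c: "Poly_Mapping.keys c \<subseteq> carrier A \<times> carrier B"
    "t = tensor_kernel A B #>\<^bsub>free_on_pairs\<^esub> c"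
    by (auto simp: tensor_group_def carrier_FactGroup)
  have "(h \<circ> (\<lambda>c. tensor_kernel A B #>\<^bsub>free_on_pairs\<^esub> c)) c = (h' \<circ> (\<lambda>c. tensor_kernel A B #>\<^bsub>free_on_pairs\<^esub> c)) c"
    by (rule hom_free_Abelian_group_eqI[OF hom_compose[OF tensor_coset_hom assms(1)]
          hom_compose[OF tensor_coset_hom assms(2)] assms(3) _ c(1)])
      (use assms(4) in \<open>auto simp: tensor_elem_def\<close>)
  then show ?thesis by (simp add: c(2))
qed

lemma tensor_group_universal:
  assumes "comm_group K"
    and closed: "\<And>x y. x \<in> carrier A \<Longrightarrow> y \<in> carrier B \<Longrightarrow> f x y \<in> carrier K"
    and left: "\<And>x x' y. x \<in> carrier A \<Longrightarrow> x' \<in> carrier A \<Longrightarrow> y \<in> carrier B \<Longrightarrow>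
      f (x \<otimes>\<^bsub>A\<^esub> x') y = f x y \<otimes>\<^bsub>K\<^esub> f x' y"
    and right: "\<And>x y y'. x \<in> carrier A \<Longrightarrow> y \<in> carrier B \<Longrightarrow> y' \<in> carrier B \<Longrightarrow>
      f x (y \<otimes>\<^bsub>B\<^esub> y') = f x y \<otimes>\<^bsub>K\<^esub> f x y'"
  obtains h where "h \<in> hom (tensor_group A B) K"
    and "\<And>x y. x \<in> carrier A \<Longrightarrow> y \<in> carrier B \<Longrightarrow> h (tensor_elem A B x y) = f x y"
proof -
  interpret K: comm_group K by fact
  obtain g where g: "g \<in> hom free_on_pairs K"
    "\<And>s. s \<in> carrier A \<times> carrier B \<Longrightarrow> g (frag_of s) = case_prod f s"
    using K.free_Abelian_group_universal[of "case_prod f" "carrier A \<times> carrier B"] closed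
    by (auto simp: image_subset_iff)
  interpret g: group_hom free_on_pairs K g
    using g(1) by (simp add: group_hom_def group_hom_axioms_def)
  have zero: "g (frag_of u - frag_of v - frag_of w) = \<one>\<^bsub>K\<^esub>"
    if "u \<in> carrier A \<times> carrier B" "v \<in> carrier A \<times> carrier B" "w \<in> carrier A \<times> carrier B"
      and eq: "case_prod f u = case_prod f v \<otimes>\<^bsub>K\<^esub> case_prod f w" for u v w
  proof -
    have vw: "Poly_Mapping.keys (frag_of v + frag_of w) \<subseteq> carrier A \<times> carrier B"
      using that g.G.m_closed[of "frag_of v" "frag_of w"] by simp
    have gvw: "g (frag_of v + frag_of w) = g (frag_of v) \<otimes>\<^bsub>K\<^esub> g (frag_of w)"
      using that g.hom_mult[of "frag_of v" "frag_of w"] by simp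
    have "g (frag_of u - (frag_of v + frag_of w)) =
        g (frag_of u) \<otimes>\<^bsub>K\<^esub> inv\<^bsub>K\<^esub> g (frag_of v + frag_of w)"
      using that vw by (intro hom_free_Abelian_group_diff[OF g(1)]) (auto simp: K.group_axioms)
    also have "\<dots> = \<one>\<^bsub>K\<^esub>"
      using that closed by (auto simp: gvw g(2))
    finally show ?thesis by (simp add: diff_diff_eq)
  qed
  have rel: "g s = \<one>\<^bsub>K\<^esub>" if "s \<in> tensor_relations A B" for s
    using that unfolding tensor_relations_def
    by (auto intro!: zero simp: left right)
  obtain h where "h \<in> hom (free_on_pairs Mod tensor_kernel A B) K"
    "\<And>x. x \<in> carrier free_on_pairs \<Longrightarrow> h (tensor_kernel A B #>\<^bsub>free_on_pairs\<^esub> x) = g x"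
    using g.FactGroup_universal_generate[OF tensor_kernel_normal[unfolded tensor_kernel_def]
        tensor_relations_carrier rel] by (auto simp: tensor_kernel_def)
  then show thesis
    by (intro that[of h]) (auto simp: tensor_group_def tensor_elem_def g(2))
qed

end

section \<open>The integral group ring and its augmentation ideal\<close>

lemma carrier_group_ring [simp]: "c \<in> carrier (group_ring G) \<longleftrightarrow> Poly_Mapping.keys c \<subseteq> carrier G"
  and zero_group_ring [simp]: "\<zero>\<^bsub>group_ring G\<^esub> = 0"
  and one_group_ring [simp]: "\<one>\<^bsub>group_ring G\<^esub> = frag_of \<one>\<^bsub>G\<^esub>"
  and add_group_ring [simp]: "c \<oplus>\<^bsub>group_ring G\<^esub> d = c + d"
  and add_monoid_group_ring: "add_monoid (group_ring G) = free_Abelian_group (carrier G)"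
  by (simp_all add: group_ring_def free_Abelian_group_def)

lemma frag_extend_add_fun: "frag_extend (\<lambda>x. f x + g x) c = frag_extend f c + frag_extend g c"
  by (simp add: frag_extend_def sum.distrib frag_cmul_distrib2)

lemma frag_extend_diff_fun: "frag_extend (\<lambda>x. f x - g x) c = frag_extend f c - frag_extend g c"
  using frag_extend_add_fun[of "\<lambda>x. f x - g x" g c] by simp

lemma group_ring_mult_of [simp]:
  "frag_of x \<otimes>\<^bsub>group_ring G\<^esub> frag_of y = frag_of (x \<otimes>\<^bsub>G\<^esub> y)"
  by (simp add: group_ring_def)

lemma group_ring_mult_zero [simp]:
  "0 \<otimes>\<^bsub>group_ring G\<^esub> c = 0" "c \<otimes>\<^bsub>group_ring G\<^esub> 0 = 0"
  by (simp_all add: group_ring_def frag_extend_eq_0)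

lemma group_ring_mult_add:
  "(c + d) \<otimes>\<^bsub>group_ring G\<^esub> e = c \<otimes>\<^bsub>group_ring G\<^esub> e + d \<otimes>\<^bsub>group_ring G\<^esub> e"
  "c \<otimes>\<^bsub>group_ring G\<^esub> (d + e) = c \<otimes>\<^bsub>group_ring G\<^esub> d + c \<otimes>\<^bsub>group_ring G\<^esub> e"
  by (simp_all add: group_ring_def frag_extend_add frag_extend_add_fun)

lemma group_ring_mult_diff:
  "(c - d) \<otimes>\<^bsub>group_ring G\<^esub> e = c \<otimes>\<^bsub>group_ring G\<^esub> e - d \<otimes>\<^bsub>group_ring G\<^esub> e"
  "c \<otimes>\<^bsub>group_ring G\<^esub> (d - e) = c \<otimes>\<^bsub>group_ring G\<^esub> d - c \<otimes>\<^bsub>group_ring G\<^esub> e"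
  by (simp_all add: group_ring_def frag_extend_diff frag_extend_diff_fun)

context group
begin

lemma group_ring_mult_closed:
  assumes "Poly_Mapping.keys c \<subseteq> carrier G" "Poly_Mapping.keys d \<subseteq> carrier G"
  shows "Poly_Mapping.keys (c \<otimes>\<^bsub>group_ring G\<^esub> d) \<subseteq> carrier G"
proof (rule free_Abelian_group_induct[OF assms(1)])
  show "Poly_Mapping.keys ((x - y) \<otimes>\<^bsub>group_ring G\<^esub> d) \<subseteq> carrier G"
    if "Poly_Mapping.keys (x \<otimes>\<^bsub>group_ring G\<^esub> d) \<subseteq> carrier G"
      "Poly_Mapping.keys (y \<otimes>\<^bsub>group_ring G\<^esub> d) \<subseteq> carrier G" for x y
    using that keys_diff by (fastforce simp: group_ring_mult_diff)
  fix a assume a: "a \<in> carrier G"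
  show "Poly_Mapping.keys (frag_of a \<otimes>\<^bsub>group_ring G\<^esub> d) \<subseteq> carrier G"
  proof (rule free_Abelian_group_induct[OF assms(2)])
    show "Poly_Mapping.keys (frag_of a \<otimes>\<^bsub>group_ring G\<^esub> (x - y)) \<subseteq> carrier G"
      if "Poly_Mapping.keys (frag_of a \<otimes>\<^bsub>group_ring G\<^esub> x) \<subseteq> carrier G"
        "Poly_Mapping.keys (frag_of a \<otimes>\<^bsub>group_ring G\<^esub> y) \<subseteq> carrier G" for x y
      using that keys_diff by (fastforce simp: group_ring_mult_diff)
  qed (use a in auto)
qed auto

lemma group_ring_mult_assoc:
  assumes "Poly_Mapping.keys c \<subseteq> carrier G" "Poly_Mapping.keys d \<subseteq> carrier G"
    "Poly_Mapping.keys e \<subseteq> carrier G"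
  shows "c \<otimes>\<^bsub>group_ring G\<^esub> d \<otimes>\<^bsub>group_ring G\<^esub> e = c \<otimes>\<^bsub>group_ring G\<^esub> (d \<otimes>\<^bsub>group_ring G\<^esub> e)"
proof (rule free_Abelian_group_induct[OF assms(1)])
  fix x assume x: "x \<in> carrier G"
  show "frag_of x \<otimes>\<^bsub>group_ring G\<^esub> d \<otimes>\<^bsub>group_ring G\<^esub> e =
      frag_of x \<otimes>\<^bsub>group_ring G\<^esub> (d \<otimes>\<^bsub>group_ring G\<^esub> e)"
  proof (rule free_Abelian_group_induct[OF assms(2)])
    fix y assume y: "y \<in> carrier G"
    show "frag_of x \<otimes>\<^bsub>group_ring G\<^esub> frag_of y \<otimes>\<^bsub>group_ring G\<^esub> e =
        frag_of x \<otimes>\<^bsub>group_ring G\<^esub> (frag_of y \<otimes>\<^bsub>group_ring G\<^esub> e)"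
      by (rule free_Abelian_group_induct[OF assms(3)])
        (use x y in \<open>simp_all add: group_ring_mult_diff m_assoc\<close>)
  qed (simp_all add: group_ring_mult_diff)
qed (simp_all add: group_ring_mult_diff)

lemma group_ring_mult_one:
  assumes "Poly_Mapping.keys c \<subseteq> carrier G"
  shows "frag_of \<one> \<otimes>\<^bsub>group_ring G\<^esub> c = c" "c \<otimes>\<^bsub>group_ring G\<^esub> frag_of \<one> = c"
  by (rule free_Abelian_group_induct[OF assms]; simp add: group_ring_mult_diff)+

lemma ring_group_ring: "ring (group_ring G)"
proof (rule ringI)
  show "abelian_group (group_ring G)"
    using abelian_free_Abelian_group[of "carrier G"]
    by (intro comm_group_abelian_groupI) (simp only: add_monoid_group_ring)
  show "Group.monoid (group_ring G)"
    by (rule monoidI)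
      (simp_all add: group_ring_mult_closed group_ring_mult_assoc group_ring_mult_one)
qed (simp_all add: group_ring_mult_add)

end

lemma augmentation_eq_sum:
  assumes "finite S" "Poly_Mapping.keys c \<subseteq> S"
  shows "augmentation c = (\<Sum>x\<in>S. Poly_Mapping.lookup c x)"
  unfolding augmentation_def
  by (rule sum.mono_neutral_left) (use assms in \<open>auto simp: in_keys_iff\<close>)

lemma augmentation_diff: "augmentation (c - d) = augmentation c - augmentation d"
proof -
  let ?S = "Poly_Mapping.keys c \<union> Poly_Mapping.keys d"
  show ?thesis
    using augmentation_eq_sum[of ?S c] augmentation_eq_sum[of ?S d]
      augmentation_eq_sum[of ?S "c - d"] keys_diff[of c d]
    by (simp add: sum_subtractf lookup_minus)
qed

lemma augmentation_zero [simp]: "augmentation 0 = 0"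
  by (simp add: augmentation_def)

lemma augmentation_of [simp]: "augmentation (frag_of x) = 1"
  by (simp add: augmentation_def)

lemma augmentation_mult:
  "augmentation (c \<otimes>\<^bsub>group_ring G\<^esub> d) = augmentation c * augmentation d"
proof (rule free_Abelian_group_induct[of c UNIV])
  fix x
  show "augmentation (frag_of x \<otimes>\<^bsub>group_ring G\<^esub> d) = augmentation (frag_of x) * augmentation d"
    by (rule free_Abelian_group_induct[of d UNIV])
      (simp_all add: group_ring_mult_diff augmentation_diff)
qed (simp_all add: group_ring_mult_diff augmentation_diff algebra_simps)

lemma aug_ideal_iff:
  "c \<in> aug_ideal G \<longleftrightarrow> Poly_Mapping.keys c \<subseteq> carrier G \<and> augmentation c = 0"
  by (simp add: aug_ideal_def)

text \<open>
  Subtracting \<open>e\<close> from every basis element changes \<open>c\<close> by a multiple of \<open>e\<close> that is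
  given by the augmentation. With \<open>e = 1\<close> and augmentation zero this shows that the elements
  \<open>a - 1\<close> generate the augmentation ideal.
\<close>

lemma augmentation_decomposition:
  "c = frag_extend (\<lambda>x. frag_of x - frag_of e) c + frag_cmul (augmentation c) (frag_of e)"
proof -
  have "frag_extend (\<lambda>x. frag_of e) c = frag_cmul (augmentation c) (frag_of e)"
    by (rule free_Abelian_group_induct[of c UNIV])
      (simp_all add: frag_extend_diff augmentation_diff frag_cmul_diff_distrib)
  then show ?thesis
    using frag_expansion[of c] by (simp add: frag_extend_diff_fun)
qed

lemma aug_ideal_induct [consumes 1, case_names zero of diff]:
  assumes "c \<in> aug_ideal G"
    and "P 0"
    and of: "\<And>a. a \<in> carrier G \<Longrightarrow> P (frag_of a - frag_of \<one>\<^bsub>G\<^esub>)"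
    and diff: "\<And>x y. P x \<Longrightarrow> P y \<Longrightarrow> P (x - y)"
  shows "P c"
proof -
  have "P (frag_extend (\<lambda>x. frag_of x - frag_of \<one>\<^bsub>G\<^esub>) c)"
  proof (rule free_Abelian_group_induct[of c "carrier G"])
    show "Poly_Mapping.keys c \<subseteq> carrier G"
      using assms(1) by (simp add: aug_ideal_iff)
  qed (simp_all add: frag_extend_diff assms(2) of diff)
  moreover have "c = frag_extend (\<lambda>x. frag_of x - frag_of \<one>\<^bsub>G\<^esub>) c"
    using augmentation_decomposition[of c "\<one>\<^bsub>G\<^esub>"] assms(1) by (simp add: aug_ideal_iff)
  ultimately show ?thesis by simp
qed

section \<open>The ideal defining the quotient for a central subgroup\<close>

text \<open>
  The product of an ideal with an additive subgroup that need not be an ideal itself is an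
  ideal if the elements of the subgroup are central. This is where centrality of \<open>B\<close> makes
  \<open>I(B)I(G)\<close> a two-sided ideal of the group ring of \<open>G\<close>.
\<close>

lemma (in ring) ideal_prod_of_commuting:
  assumes A: "additive_subgroup A R" and J: "ideal J R"
    and comm: "\<And>a x. a \<in> A \<Longrightarrow> x \<in> carrier R \<Longrightarrow> x \<otimes> a = a \<otimes> x"
  shows "ideal (A \<cdot> J) R"
proof -
  interpret A: additive_subgroup A R by fact
  interpret J: ideal J R by fact
  have carr: "s \<in> carrier R" if "s \<in> A \<cdot> J" for s
    using that by induction (auto simp: J.Icarr)
  show ?thesis
  proof (rule idealI[OF ring_axioms])
    show "subgroup (A \<cdot> J) (add_monoid R)"
    proof
      show "\<one>\<^bsub>add_monoid R\<^esub> \<in> A \<cdot> J"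
        using ideal_prod.prod[of \<zero> A \<zero> J R] by simp
      show "inv\<^bsub>add_monoid R\<^esub> s \<in> A \<cdot> J" if "s \<in> A \<cdot> J" for s
        using that
      proof induction
        case (prod i j)
        then have "\<ominus> (i \<otimes> j) = (\<ominus> i) \<otimes> j"
          by (simp add: l_minus J.Icarr)
        then show ?case
          using ideal_prod.prod[of "\<ominus> i" A j J R] prod by (simp add: a_inv_def[symmetric])
      next
        case (sum s1 s2)
        then have "\<ominus> (s1 \<oplus> s2) = \<ominus> s1 \<oplus> \<ominus> s2"
          using carr by (simp add: minus_add)
        then show ?case
          using sum by (simp add: a_inv_def[symmetric] ideal_prod.sum)
      qed
    qed (auto simp: carr ideal_prod.sum)
  next
    fix s x assume s: "s \<in> A \<cdot> J" and x: "x \<in> carrier R"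
    show "x \<otimes> s \<in> A \<cdot> J"
      using s
    proof induction
      case (prod i j)
      then have "x \<otimes> (i \<otimes> j) = i \<otimes> (x \<otimes> j)"
        using x comm[of i x] by (simp add: J.Icarr flip: m_assoc)
      then show ?case
        using prod x by (simp add: ideal_prod.prod J.I_l_closed)
    next
      case (sum s1 s2)
      then show ?case
        using x carr by (simp add: r_distr ideal_prod.sum)
    qed
    show "s \<otimes> x \<in> A \<cdot> J"
      using s
    proof induction
      case (prod i j)
      then have "(i \<otimes> j) \<otimes> x = i \<otimes> (j \<otimes> x)"
        using x by (simp add: J.Icarr m_assoc)
      then show ?case
        using prod x by (simp add: ideal_prod.prod J.I_r_closed)
    next
      case (sum s1 s2)
      then show ?case
        using x carr by (simp add: l_distr ideal_prod.sum)
    qed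
  qed
qed

lemma P2_idealE:
  assumes "c \<in> P2_ideal G B"
  obtains u v where "u \<in> ideal_prod (group_ring G) (aug_ideal (G\<lparr>carrier := B\<rparr>)) (aug_ideal G)"
    and "v \<in> ideal_prod (group_ring G)
      (ideal_prod (group_ring G) (aug_ideal G) (aug_ideal G)) (aug_ideal G)"
    and "c = u + v"
  using assms by (auto simp: P2_ideal_def set_add_def')

text \<open>
  A group with a central subgroup.
\<close>

locale central_subgroup = subgroup B G + group G for B and G (structure) +
  assumes central: "b \<in> B \<Longrightarrow> g \<in> carrier G \<Longrightarrow> b \<otimes> g = g \<otimes> b"
begin

text \<open>
  The group ring, its additive group, and its augmentation ideal.
\<close>

abbreviation "ZG \<equiv> group_ring G"

abbreviation "FG \<equiv> free_Abelian_group (carrier G)"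

abbreviation "IG \<equiv> aug_ideal G"

text \<open>
  The element \<open>a - 1\<close> of the augmentation ideal.
\<close>

abbreviation delta ("\<delta>") where "\<delta> a \<equiv> frag_of a - frag_of \<one>"

sublocale ZG: ring ZG by (rule ring_group_ring)

lemma delta_aug_ideal [simp, intro]: "a \<in> carrier G \<Longrightarrow> \<delta> a \<in> IG"
  using keys_diff[of "frag_of a" "frag_of \<one>"] by (auto simp: aug_ideal_iff augmentation_diff)

lemma delta_keys [simp, intro]: "a \<in> carrier G \<Longrightarrow> Poly_Mapping.keys (\<delta> a) \<subseteq> carrier G"
  using delta_aug_ideal by (simp add: aug_ideal_iff)

text \<open>
  The identity \<open>ab - 1 = (a - 1) + (b - 1) + (a - 1)(b - 1)\<close>, from which all quadratic
  behaviour derives.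
\<close>

lemma delta_mult:
  "\<delta> (a \<otimes> b) = \<delta> a + \<delta> b + \<delta> a \<otimes>\<^bsub>ZG\<^esub> \<delta> b" if "a \<in> carrier G" "b \<in> carrier G"
  using that by (simp add: group_ring_mult_diff)

lemma subgroup_aug_ideal: "subgroup IG FG"
proof
  show "x \<otimes>\<^bsub>FG\<^esub> y \<in> IG" if "x \<in> IG" "y \<in> IG" for x y
    using that augmentation_diff[of x "-y"] augmentation_diff[of 0 y] keys_add[of x y]
    by (auto simp: aug_ideal_iff)
  show "inv\<^bsub>FG\<^esub> x \<in> IG" if "x \<in> IG" for x
    using that augmentation_diff[of 0 x] by (simp add: aug_ideal_iff)
qed (auto simp: aug_ideal_iff)

lemma ideal_aug_ideal: "ideal IG ZG"
proof (rule idealI[OF ZG.ring_axioms])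
  show "subgroup IG (add_monoid ZG)"
    unfolding add_monoid_group_ring by (rule subgroup_aug_ideal)
qed (simp_all add: aug_ideal_iff group_ring_mult_closed augmentation_mult)

sublocale IG: ideal IG ZG by (rule ideal_aug_ideal)

text \<open>
  The augmentation ideal of the group ring of \<open>B\<close>, as a set of elements of the group ring of
  \<open>G\<close>. It need not be an ideal there.
\<close>

abbreviation "IB \<equiv> aug_ideal (G\<lparr>carrier := B\<rparr>)"

lemma aug_ideal_subgroup_subset: "IB \<subseteq> IG"
  using subset by (fastforce simp: aug_ideal_iff)

lemma aug_ideal_subgroup_commute:
  assumes "c \<in> IB" "d \<in> carrier ZG"
  shows "d \<otimes>\<^bsub>ZG\<^esub> c = c \<otimes>\<^bsub>ZG\<^esub> d"
proof -
  have "Poly_Mapping.keys c \<subseteq> B" "Poly_Mapping.keys d \<subseteq> carrier G"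
    using assms by (simp_all add: aug_ideal_iff)
  from this(1) show ?thesis
  proof (rule free_Abelian_group_induct)
    fix b assume b: "b \<in> B"
    show "d \<otimes>\<^bsub>ZG\<^esub> frag_of b = frag_of b \<otimes>\<^bsub>ZG\<^esub> d"
      using \<open>Poly_Mapping.keys d \<subseteq> carrier G\<close>
      by (rule free_Abelian_group_induct) (use b in \<open>simp_all add: group_ring_mult_diff central\<close>)
  qed (simp_all add: group_ring_mult_diff)
qed

lemma additive_subgroup_aug_ideal_subgroup: "additive_subgroup IB ZG"
proof (rule additive_subgroupI)
  \<comment> \<open>The subgroup \<open>B\<close> is abelian, hence a central subgroup of itself.\<close>
  interpret B: central_subgroup B "G\<lparr>carrier := B\<rparr>"
  proof -
    interpret B: group "G\<lparr>carrier := B\<rparr>" by (rule subgroup_is_group) (rule group_axioms)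
    show "central_subgroup B (G\<lparr>carrier := B\<rparr>)"
      by unfold_locales (auto simp: central B.inv_closed[simplified])
  qed
  have "subgroup IB (free_Abelian_group B)"
    using B.subgroup_aug_ideal by simp
  moreover have "Poly_Mapping.keys x \<subseteq> carrier G" if "x \<in> IB" for x
    using that subset by (fastforce simp: aug_ideal_iff)
  ultimately show "subgroup IB (add_monoid ZG)"
    unfolding add_monoid_group_ring
    by (auto simp: subgroup_def aug_ideal_iff)
qed

text \<open>
  The ideal \<open>I(B)I(G) + I\<^sup>3(G)\<close>.
\<close>

abbreviation "J \<equiv> P2_ideal G B"

lemma ideal_P2_ideal: "ideal J ZG"
  unfolding P2_ideal_def
  by (intro ZG.add_ideals ZG.ideal_prod_of_commuting ZG.ideal_prod_is_ideal ideal_aug_ideal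
      additive_subgroup_aug_ideal_subgroup aug_ideal_subgroup_commute)

sublocale J: ideal J ZG by (rule ideal_P2_ideal)

lemma ideal_prod_subset_IG:
  assumes "X \<subseteq> carrier ZG" "u \<in> ideal_prod ZG X IG"
  shows "u \<in> IG"
  using assms(2) by induction (use assms(1) IG.I_l_closed IG.a_closed in auto)

lemma P2_ideal_subset: "J \<subseteq> IG"
proof
  fix c assume "c \<in> J"
  then obtain u v where "u \<in> ideal_prod ZG IB IG" "v \<in> ideal_prod ZG (ideal_prod ZG IG IG) IG"
    "c = u \<oplus>\<^bsub>ZG\<^esub> v"
    by (rule P2_idealE) simp
  then show "c \<in> IG"
    using ideal_prod_subset_IG[of IB u] ideal_prod_subset_IG[of "ideal_prod ZG IG IG" v]
      aug_ideal_subgroup_subset IG.a_subset ZG.ideal_prod_in_carrier[OF ideal_aug_ideal ideal_aug_ideal]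
      IG.a_closed by blast
qed

lemma P2_ideal_IB_IG: "c \<in> IB \<Longrightarrow> d \<in> IG \<Longrightarrow> c \<otimes>\<^bsub>ZG\<^esub> d \<in> J"
proof -
  assume "c \<in> IB" "d \<in> IG"
  then have "c \<otimes>\<^bsub>ZG\<^esub> d \<in> ideal_prod ZG IB IG" by (rule ideal_prod.prod)
  \<comment> \<open>Zero is written as a product to see that it lies in the other summand.\<close>
  moreover have "0 \<otimes>\<^bsub>ZG\<^esub> 0 \<otimes>\<^bsub>ZG\<^esub> 0 \<in> ideal_prod ZG (ideal_prod ZG IG IG) IG"
    using IG.zero_closed by (intro ideal_prod.prod) auto
  ultimately show ?thesis
    unfolding P2_ideal_def set_add_def' by force
qed

lemma P2_ideal_IG3: "c \<in> IG \<Longrightarrow> d \<in> IG \<Longrightarrow> e \<in> IG \<Longrightarrow> c \<otimes>\<^bsub>ZG\<^esub> d \<otimes>\<^bsub>ZG\<^esub> e \<in> J"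
proof -
  assume "c \<in> IG" "d \<in> IG" "e \<in> IG"
  then have "c \<otimes>\<^bsub>ZG\<^esub> d \<otimes>\<^bsub>ZG\<^esub> e \<in> ideal_prod ZG (ideal_prod ZG IG IG) IG"
    by (intro ideal_prod.prod)
  moreover have "0 \<otimes>\<^bsub>ZG\<^esub> 0 \<in> ideal_prod ZG IB IG"
    using IG.zero_closed additive_subgroup.zero_closed[OF additive_subgroup_aug_ideal_subgroup]
    by (intro ideal_prod.prod) auto
  ultimately show ?thesis
    unfolding P2_ideal_def set_add_def' by force
qed

text \<open>
  The additive group of \<open>P\<^sub>2(G,B)\<close>, that is, the augmentation ideal modulo the ideal above. It
  is kept as a constant because the simplifier would unfold the record that defines it.
\<close>

definition P where "P = add_monoid (P2 G B)"

text \<open>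
  The additive group of \<open>I(G)\<close>.
\<close>

abbreviation "FI \<equiv> FG\<lparr>carrier := IG\<rparr>"

lemma P_eq: "P = FI Mod J"
  by (simp add: P_def P2_def FactRing_def FactGroup_def A_RCOSETS_def RCOSETS_def r_coset_def set_add_def
      set_mult_def group_ring_def free_Abelian_group_def)

lemma comm_group_FI: "comm_group FI"
  using group.subgroup_imp_group[OF group_free_Abelian_group subgroup_aug_ideal]
  by (rule group.group_comm_groupI) simp

lemma subgroup_P2_ideal: "subgroup J FI"
proof -
  have "subgroup J FG" using J.a_subgroup unfolding add_monoid_group_ring .
  then show ?thesis
    by (intro group.subgroup_incl group_free_Abelian_group subgroup_aug_ideal P2_ideal_subset)
qed

lemma normal_P2_ideal: "J \<lhd> FI"
  using comm_group.normal_iff_subgroup[OF comm_group_FI] subgroup_P2_ideal by blast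

lemma comm_group_P: "comm_group P"
  unfolding P_eq by (rule comm_group.abelian_FactGroup[OF comm_group_FI subgroup_P2_ideal])

sublocale P: comm_group P by (rule comm_group_P)

lemma rho_eq': "rho G B c = J #>\<^bsub>FG\<^esub> c"
  unfolding rho_def a_r_coset_def add_monoid_group_ring ..

lemma rho_eq: "rho G B c = J #>\<^bsub>FI\<^esub> c"
  unfolding rho_eq' by (simp add: r_coset_def)

lemma carrier_P: "carrier P = rho G B ` IG"
  by (simp add: P_eq carrier_FactGroup rho_eq image_def)

lemma rho_hom: "rho G B \<in> hom FI P"
  using normal.r_coset_hom_Mod[OF normal_P2_ideal] by (simp add: P_eq rho_eq[abs_def])

lemma rho_closed [simp, intro]: "c \<in> IG \<Longrightarrow> rho G B c \<in> carrier P"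
  unfolding carrier_P by blast

lemma rho_add: "c \<in> IG \<Longrightarrow> d \<in> IG \<Longrightarrow> rho G B (c + d) = rho G B c \<otimes>\<^bsub>P\<^esub> rho G B d"
  using hom_mult[OF rho_hom, of c d] by simp

lemma rho_zero: "c \<in> J \<Longrightarrow> rho G B c = \<one>\<^bsub>P\<^esub>"
  using subgroup_P2_ideal
  by (metis P_eq comm_group.axioms(2) comm_group_FI group.coset_join2 one_FactGroup rho_eq
      subgroup.mem_carrier)

text \<open>
  Products in \<open>P\<^sub>2(G,B)\<close> are formed in the ring without unit \<open>I(G)\<close>; since the ideal is
  even one of the whole group ring, they can be computed on representatives there.
\<close>

lemma rho_mult: "c \<in> IG \<Longrightarrow> d \<in> IG \<Longrightarrow> rho G B c \<otimes>\<^bsub>P2 G B\<^esub> rho G B d = rho G B (c \<otimes>\<^bsub>ZG\<^esub> d)"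
  using J.rcoset_mult_add[of c d]
  by (simp add: rho_def P2_def FactRing_def rcoset_mult_def a_r_coset_def r_coset_def aug_ideal_iff)

lemma p2_closed [simp, intro]: "a \<in> carrier G \<Longrightarrow> p2 G B a \<in> carrier P"
  unfolding p2_def by blast

lemma p2_prod: "a \<in> carrier G \<Longrightarrow> b \<in> carrier G \<Longrightarrow>
    p2 G B a \<otimes>\<^bsub>P2 G B\<^esub> p2 G B b = rho G B (\<delta> a \<otimes>\<^bsub>ZG\<^esub> \<delta> b)"
  by (simp add: p2_def rho_mult)

text \<open>
  The map \<open>p\<^sub>2\<close> is quadratic with deviation \<open>p\<^sub>2(a) p\<^sub>2(b)\<close>, which is additive in either
  argument because \<open>I\<^sup>3(G)\<close> has been divided out, and vanishes on \<open>B\<close> because \<open>I(B)I(G)\<close> has.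
\<close>

lemma p2_mult:
  assumes "a \<in> carrier G" "b \<in> carrier G"
  shows "p2 G B (a \<otimes> b) = p2 G B a \<otimes>\<^bsub>P\<^esub> p2 G B b \<otimes>\<^bsub>P\<^esub> (p2 G B a \<otimes>\<^bsub>P2 G B\<^esub> p2 G B b)"
  unfolding p2_prod[OF assms] unfolding p2_def delta_mult[OF assms]
  using assms IG.I_l_closed[of "\<delta> b" "\<delta> a"] IG.a_closed[of "\<delta> a" "\<delta> b"]
  by (subst rho_add rho_add; simp)+

lemma delta_prod_closed: "a \<in> carrier G \<Longrightarrow> b \<in> carrier G \<Longrightarrow> \<delta> a \<otimes>\<^bsub>ZG\<^esub> \<delta> b \<in> IG"
  using IG.I_l_closed[of "\<delta> b" "\<delta> a"] by simp

lemma p2_prod_closed: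
  "a \<in> carrier G \<Longrightarrow> b \<in> carrier G \<Longrightarrow> p2 G B a \<otimes>\<^bsub>P2 G B\<^esub> p2 G B b \<in> carrier P"
  by (simp add: p2_prod delta_prod_closed rho_closed)

lemma p2_prod_mult_left:
  assumes "a \<in> carrier G" "a' \<in> carrier G" "b \<in> carrier G"
  shows "p2 G B (a \<otimes> a') \<otimes>\<^bsub>P2 G B\<^esub> p2 G B b =
    (p2 G B a \<otimes>\<^bsub>P2 G B\<^esub> p2 G B b) \<otimes>\<^bsub>P\<^esub> (p2 G B a' \<otimes>\<^bsub>P2 G B\<^esub> p2 G B b)"
proof -
  have "\<delta> (a \<otimes> a') \<otimes>\<^bsub>ZG\<^esub> \<delta> b =
      \<delta> a \<otimes>\<^bsub>ZG\<^esub> \<delta> b + \<delta> a' \<otimes>\<^bsub>ZG\<^esub> \<delta> b + \<delta> a \<otimes>\<^bsub>ZG\<^esub> \<delta> a' \<otimes>\<^bsub>ZG\<^esub> \<delta> b"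
    using assms by (simp only: delta_mult group_ring_mult_add)
  moreover have triple: "\<delta> a \<otimes>\<^bsub>ZG\<^esub> \<delta> a' \<otimes>\<^bsub>ZG\<^esub> \<delta> b \<in> J"
    using assms by (intro P2_ideal_IG3) auto
  moreover have "\<delta> a \<otimes>\<^bsub>ZG\<^esub> \<delta> b \<in> IG" "\<delta> a' \<otimes>\<^bsub>ZG\<^esub> \<delta> b \<in> IG"
    "\<delta> a \<otimes>\<^bsub>ZG\<^esub> \<delta> b + \<delta> a' \<otimes>\<^bsub>ZG\<^esub> \<delta> b \<in> IG"
    using assms delta_prod_closed IG.a_closed by auto
  ultimately show ?thesis
    using assms P2_ideal_subset
    by (simp add: p2_prod rho_add rho_zero subset_iff)
qed

lemma p2_prod_mult_right:
  assumes "a \<in> carrier G" "b \<in> carrier G" "b' \<in> carrier G"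
  shows "p2 G B a \<otimes>\<^bsub>P2 G B\<^esub> p2 G B (b \<otimes> b') =
    (p2 G B a \<otimes>\<^bsub>P2 G B\<^esub> p2 G B b) \<otimes>\<^bsub>P\<^esub> (p2 G B a \<otimes>\<^bsub>P2 G B\<^esub> p2 G B b')"
proof -
  have "\<delta> a \<otimes>\<^bsub>ZG\<^esub> \<delta> (b \<otimes> b') =
      \<delta> a \<otimes>\<^bsub>ZG\<^esub> \<delta> b + \<delta> a \<otimes>\<^bsub>ZG\<^esub> \<delta> b' + \<delta> a \<otimes>\<^bsub>ZG\<^esub> \<delta> b \<otimes>\<^bsub>ZG\<^esub> \<delta> b'"
    using assms by (simp only: delta_mult group_ring_mult_add group_ring_mult_assoc delta_keys)
  moreover have triple: "\<delta> a \<otimes>\<^bsub>ZG\<^esub> \<delta> b \<otimes>\<^bsub>ZG\<^esub> \<delta> b' \<in> J"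
    using assms by (intro P2_ideal_IG3) auto
  moreover have "\<delta> a \<otimes>\<^bsub>ZG\<^esub> \<delta> b \<in> IG" "\<delta> a \<otimes>\<^bsub>ZG\<^esub> \<delta> b' \<in> IG"
    "\<delta> a \<otimes>\<^bsub>ZG\<^esub> \<delta> b + \<delta> a \<otimes>\<^bsub>ZG\<^esub> \<delta> b' \<in> IG"
    using assms delta_prod_closed IG.a_closed by auto
  ultimately show ?thesis
    using assms P2_ideal_subset
    by (simp add: p2_prod rho_add rho_zero subset_iff)
qed

lemma p2_prod_central:
  assumes "b \<in> B" "g \<in> carrier G"
  shows "p2 G B b \<otimes>\<^bsub>P2 G B\<^esub> p2 G B g = \<one>\<^bsub>P\<^esub>" "p2 G B g \<otimes>\<^bsub>P2 G B\<^esub> p2 G B b = \<one>\<^bsub>P\<^esub>"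
proof -
  have b: "\<delta> b \<in> IB" "b \<in> carrier G"
    using assms one_closed keys_diff[of "frag_of b" "frag_of \<one>"]
    by (auto simp: aug_ideal_iff augmentation_diff)
  then have "\<delta> b \<otimes>\<^bsub>ZG\<^esub> \<delta> g \<in> J" "\<delta> g \<otimes>\<^bsub>ZG\<^esub> \<delta> b = \<delta> b \<otimes>\<^bsub>ZG\<^esub> \<delta> g"
    using assms by (auto intro!: P2_ideal_IB_IG aug_ideal_subgroup_commute)
  then show "p2 G B b \<otimes>\<^bsub>P2 G B\<^esub> p2 G B g = \<one>\<^bsub>P\<^esub>" "p2 G B g \<otimes>\<^bsub>P2 G B\<^esub> p2 G B b = \<one>\<^bsub>P\<^esub>"
    using assms b by (simp_all add: p2_prod rho_zero)
qed

end

section \<open>The universal property of \<open>p\<^sub>2\<close>\<close>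

lemma (in group_hom) derived_imp_one:
  assumes "comm_group H" "d \<in> derived G (carrier G)"
  shows "h d = \<one>\<^bsub>H\<^esub>"
proof -
  have "h ` derived G (carrier G) = {\<one>\<^bsub>H\<^esub>}"
    using derived_img[of "carrier G"] img_is_subgroup[THEN subgroup.subset]
      comm_group.derived_eq_singleton[OF assms(1), of "h ` carrier G"] by simp
  then show ?thesis using assms(2) by blast
qed

lemma hom_aug_ideal_eq_one:
  assumes "group H" "h \<in> hom (free_Abelian_group (carrier H)) K" "group K"
    and one: "\<And>a. a \<in> carrier H \<Longrightarrow> h (frag_of a - frag_of \<one>\<^bsub>H\<^esub>) = \<one>\<^bsub>K\<^esub>"
    and "c \<in> aug_ideal H"
  shows "h c = \<one>\<^bsub>K\<^esub>"
proof -
  interpret H: group H by fact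
  interpret h: group_hom "free_Abelian_group (carrier H)" K h
    using assms by (simp add: group_hom_def group_hom_axioms_def)
  from assms(5) have "Poly_Mapping.keys c \<subseteq> carrier H \<and> h c = \<one>\<^bsub>K\<^esub>"
  proof (induction rule: aug_ideal_induct)
    case zero
    show ?case using h.hom_one by simp
  next
    case (of a)
    then show ?case using one[of a] keys_diff[of "frag_of a" "frag_of \<one>\<^bsub>H\<^esub>"] by auto
  next
    case (diff x y)
    then show ?case
      using keys_diff[of x y] by (auto simp: hom_free_Abelian_group_diff[OF assms(2,3)])
  qed
  then show ?thesis ..
qed

context central_subgroup
begin

lemma hom_right_mult:
  assumes "h \<in> hom FG K" "Poly_Mapping.keys d \<subseteq> carrier G"
  shows "(\<lambda>c. h (c \<otimes>\<^bsub>ZG\<^esub> d)) \<in> hom FG K"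
proof (rule homI)
  fix c assume "c \<in> carrier FG"
  then show "h (c \<otimes>\<^bsub>ZG\<^esub> d) \<in> carrier K"
    using hom_in_carrier[OF assms(1)] group_ring_mult_closed[of c d] assms(2) by simp
next
  fix c c' assume "c \<in> carrier FG" "c' \<in> carrier FG"
  then show "h ((c \<otimes>\<^bsub>FG\<^esub> c') \<otimes>\<^bsub>ZG\<^esub> d) = h (c \<otimes>\<^bsub>ZG\<^esub> d) \<otimes>\<^bsub>K\<^esub> h (c' \<otimes>\<^bsub>ZG\<^esub> d)"
    using hom_mult[OF assms(1), of "c \<otimes>\<^bsub>ZG\<^esub> d" "c' \<otimes>\<^bsub>ZG\<^esub> d"] group_ring_mult_closed assms(2)
    by (simp add: group_ring_mult_add)
qed

lemma hom_left_mult: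
  assumes "h \<in> hom FG K" "Poly_Mapping.keys c \<subseteq> carrier G"
  shows "(\<lambda>d. h (c \<otimes>\<^bsub>ZG\<^esub> d)) \<in> hom FG K"
proof (rule homI)
  fix d assume "d \<in> carrier FG"
  then show "h (c \<otimes>\<^bsub>ZG\<^esub> d) \<in> carrier K"
    using hom_in_carrier[OF assms(1)] group_ring_mult_closed[of c d] assms(2) by simp
next
  fix d d' assume "d \<in> carrier FG" "d' \<in> carrier FG"
  then show "h (c \<otimes>\<^bsub>ZG\<^esub> (d \<otimes>\<^bsub>FG\<^esub> d')) = h (c \<otimes>\<^bsub>ZG\<^esub> d) \<otimes>\<^bsub>K\<^esub> h (c \<otimes>\<^bsub>ZG\<^esub> d')"
    using hom_mult[OF assms(1), of "c \<otimes>\<^bsub>ZG\<^esub> d" "c \<otimes>\<^bsub>ZG\<^esub> d'"] group_ring_mult_closed assms(2)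
    by (simp add: group_ring_mult_add)
qed

lemma hom_ideal_prod_eq_one:
  assumes "h \<in> hom FG K" "group K" "X \<subseteq> carrier ZG" "Y \<subseteq> carrier ZG"
    and "\<And>i j. i \<in> X \<Longrightarrow> j \<in> Y \<Longrightarrow> h (i \<otimes>\<^bsub>ZG\<^esub> j) = \<one>\<^bsub>K\<^esub>"
    and "u \<in> ideal_prod ZG X Y"
  shows "h u = \<one>\<^bsub>K\<^esub>"
proof -
  interpret K: group K by fact
  from assms(6) have "u \<in> carrier ZG \<and> h u = \<one>\<^bsub>K\<^esub>"
  proof induction
    case (prod i j)
    then show ?case using assms(3-5) ZG.m_closed[of i j] by blast
  next
    case (sum s t)
    then show ?case
      using hom_mult[OF assms(1), of s t] ZG.a_closed[of s t] by simp
  qed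
  then show ?thesis ..
qed

text \<open>
  Every map \<open>f\<close> into an abelian group that is quadratic relative \<open>B\<close>, with deviation \<open>e\<close>,
  factors through \<open>p\<^sub>2\<close>. Extended linearly to the group ring, \<open>f\<close> takes \<open>a - 1\<close> to \<open>f a\<close>, then
  \<open>(a - 1)(b - 1)\<close> to \<open>e a b\<close>, and \<open>(a - 1)(b - 1)(c - 1)\<close> to
  \<open>e (ab) c - e a c - e b c = 0\<close> (in additive notation), so that it kills the ideal. Additivity
  of \<open>e\<close> in the first argument is enough for this.
\<close>

lemma P2_universal:
  assumes K: "comm_group K"
    and f: "\<And>a. a \<in> carrier G \<Longrightarrow> f a \<in> carrier K"
    and e: "\<And>a b. a \<in> carrier G \<Longrightarrow> b \<in> carrier G \<Longrightarrow> e a b \<in> carrier K"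
    and f_mult: "\<And>a b. a \<in> carrier G \<Longrightarrow> b \<in> carrier G \<Longrightarrow>
      f (a \<otimes> b) = f a \<otimes>\<^bsub>K\<^esub> f b \<otimes>\<^bsub>K\<^esub> e a b"
    and e_left: "\<And>a a' b. a \<in> carrier G \<Longrightarrow> a' \<in> carrier G \<Longrightarrow> b \<in> carrier G \<Longrightarrow>
      e (a \<otimes> a') b = e a b \<otimes>\<^bsub>K\<^esub> e a' b"
    and e_central: "\<And>b g. b \<in> B \<Longrightarrow> g \<in> carrier G \<Longrightarrow> e b g = \<one>\<^bsub>K\<^esub>"
  obtains h where "h \<in> hom P K" "\<And>a. a \<in> carrier G \<Longrightarrow> h (p2 G B a) = f a"
proof -
  interpret K: comm_group K by fact
  note grK = K.group_axioms
  obtain F where F: "F \<in> hom FG K" "\<And>a. a \<in> carrier G \<Longrightarrow> F (frag_of a) = f a"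
    using K.free_Abelian_group_universal[of f "carrier G"] f by (auto simp: image_subset_iff)
  have f_one: "f \<one> = \<one>\<^bsub>K\<^esub>"
    using f_mult[of \<one> \<one>] e_central[of \<one> \<one>] f[of \<one>] one_closed by simp
  have F_delta: "F (\<delta> a) = f a" if "a \<in> carrier G" for a
    using that f by (simp add: hom_free_Abelian_group_diff[OF F(1) grK] F(2) f_one)
  have keys_prod: "Poly_Mapping.keys (c \<otimes>\<^bsub>ZG\<^esub> d) \<subseteq> carrier G" if "c \<in> IG" "d \<in> IG" for c d
    using that group_ring_mult_closed by (simp add: aug_ideal_iff)
  have F_add: "F (c + d) = F c \<otimes>\<^bsub>K\<^esub> F d" "F c \<in> carrier K" if "c \<in> IG" "d \<in> IG" for c d
    using that hom_mult[OF F(1), of c d] hom_in_carrier[OF F(1), of c] by (simp_all add: aug_ideal_iff)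
  have F_delta2: "F (\<delta> a \<otimes>\<^bsub>ZG\<^esub> \<delta> b) = e a b" if "a \<in> carrier G" "b \<in> carrier G" for a b
  proof -
    have "f (a \<otimes> b) = F (\<delta> a + \<delta> b + \<delta> a \<otimes>\<^bsub>ZG\<^esub> \<delta> b)"
      using that F_delta[of "a \<otimes> b"] by (simp only: delta_mult m_closed)
    also have "\<dots> = f a \<otimes>\<^bsub>K\<^esub> f b \<otimes>\<^bsub>K\<^esub> F (\<delta> a \<otimes>\<^bsub>ZG\<^esub> \<delta> b)"
      using that delta_prod_closed[of a b] IG.a_closed[of "\<delta> a" "\<delta> b"]
      by (simp add: F_add F_delta)
    finally show ?thesis
      using that f e F_add(2)[OF delta_prod_closed delta_prod_closed] by (simp add: f_mult)
  qed
  have F_delta3: "F (\<delta> a \<otimes>\<^bsub>ZG\<^esub> \<delta> b \<otimes>\<^bsub>ZG\<^esub> \<delta> c) = \<one>\<^bsub>K\<^esub>"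
    if "a \<in> carrier G" "b \<in> carrier G" "c \<in> carrier G" for a b c
  proof -
    have triple: "\<delta> a \<otimes>\<^bsub>ZG\<^esub> \<delta> b \<otimes>\<^bsub>ZG\<^esub> \<delta> c \<in> IG"
      using that by (intro subsetD[OF P2_ideal_subset P2_ideal_IG3]) auto
    have "e (a \<otimes> b) c = F (\<delta> a \<otimes>\<^bsub>ZG\<^esub> \<delta> c + \<delta> b \<otimes>\<^bsub>ZG\<^esub> \<delta> c + \<delta> a \<otimes>\<^bsub>ZG\<^esub> \<delta> b \<otimes>\<^bsub>ZG\<^esub> \<delta> c)"
      using that F_delta2[of "a \<otimes> b" c] by (simp only: delta_mult m_closed group_ring_mult_add)
    also have "\<dots> = e a c \<otimes>\<^bsub>K\<^esub> e b c \<otimes>\<^bsub>K\<^esub> F (\<delta> a \<otimes>\<^bsub>ZG\<^esub> \<delta> b \<otimes>\<^bsub>ZG\<^esub> \<delta> c)"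
      using that triple delta_prod_closed IG.a_closed[of "\<delta> a \<otimes>\<^bsub>ZG\<^esub> \<delta> c" "\<delta> b \<otimes>\<^bsub>ZG\<^esub> \<delta> c"]
      by (simp add: F_add F_delta2)
    finally show ?thesis
      using that e F_add(2)[OF triple triple] by (simp add: e_left)
  qed
  \<comment> \<open>The map \<open>F\<close> is determined by its values on products of elements \<open>a - 1\<close>, one factor at a time.\<close>
  note aug_one = hom_aug_ideal_eq_one[OF group_axioms _ grK]
  have F_IB_IG: "F (c \<otimes>\<^bsub>ZG\<^esub> d) = \<one>\<^bsub>K\<^esub>" if "c \<in> IB" "d \<in> IG" for c d
  proof (rule hom_aug_ideal_eq_one[of "G\<lparr>carrier := B\<rparr>" "\<lambda>c. F (c \<otimes>\<^bsub>ZG\<^esub> d)" K])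
    show "group (G\<lparr>carrier := B\<rparr>)" by (rule subgroup_is_group) (rule group_axioms)
    have "(\<lambda>c. F (c \<otimes>\<^bsub>ZG\<^esub> d)) \<in> hom FG K"
      using that by (intro hom_right_mult F(1)) (simp add: aug_ideal_iff)
    then show "(\<lambda>c. F (c \<otimes>\<^bsub>ZG\<^esub> d)) \<in> hom (free_Abelian_group (carrier (G\<lparr>carrier := B\<rparr>))) K"
      using subset by (fastforce simp: hom_def)
    fix b assume "b \<in> carrier (G\<lparr>carrier := B\<rparr>)"
    then have b: "b \<in> B" "b \<in> carrier G" by auto
    have "F (\<delta> b \<otimes>\<^bsub>ZG\<^esub> d) = \<one>\<^bsub>K\<^esub>"
      by (rule aug_one[OF hom_left_mult[OF F(1)]]) (use b that in \<open>simp_all add: F_delta2 e_central delta_keys\<close>)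
    then show "F ((frag_of b - frag_of \<one>\<^bsub>G\<lparr>carrier := B\<rparr>\<^esub>) \<otimes>\<^bsub>ZG\<^esub> d) = \<one>\<^bsub>K\<^esub>" by simp
  qed (use that grK in auto)
  have F_IG3: "F (c \<otimes>\<^bsub>ZG\<^esub> d \<otimes>\<^bsub>ZG\<^esub> d') = \<one>\<^bsub>K\<^esub>" if "c \<in> IG" "d \<in> IG" "d' \<in> IG" for c d d'
  proof -
    have k: "Poly_Mapping.keys c \<subseteq> carrier G" "Poly_Mapping.keys d \<subseteq> carrier G"
      "Poly_Mapping.keys d' \<subseteq> carrier G"
      using that by (auto simp: aug_ideal_iff)
    show ?thesis
    proof (rule aug_one[OF hom_right_mult[OF hom_right_mult[OF F(1) k(3)] k(2)] _ that(1)])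
      fix x assume x: "x \<in> carrier G"
      show "F (\<delta> x \<otimes>\<^bsub>ZG\<^esub> d \<otimes>\<^bsub>ZG\<^esub> d') = \<one>\<^bsub>K\<^esub>"
      proof (rule aug_one[OF hom_left_mult[OF hom_right_mult[OF F(1) k(3)] delta_keys[OF x]] _ that(2)])
        fix y assume y: "y \<in> carrier G"
        have "Poly_Mapping.keys (\<delta> x \<otimes>\<^bsub>ZG\<^esub> \<delta> y) \<subseteq> carrier G"
          using x y by (simp add: keys_prod)
        then show "F (\<delta> x \<otimes>\<^bsub>ZG\<^esub> \<delta> y \<otimes>\<^bsub>ZG\<^esub> d') = \<one>\<^bsub>K\<^esub>"
          by (rule aug_one[OF hom_left_mult[OF F(1)] _ that(3)]) (use x y in \<open>simp add: F_delta3\<close>)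
      qed
    qed
  qed
  have IG_carrier: "IG \<subseteq> carrier ZG" and IB_carrier: "IB \<subseteq> carrier ZG"
    using IG.a_subset aug_ideal_subgroup_subset by auto
  have F_J: "F c = \<one>\<^bsub>K\<^esub>" if c: "c \<in> J" for c
  proof -
    obtain u v where uv: "u \<in> ideal_prod ZG IB IG" "v \<in> ideal_prod ZG (ideal_prod ZG IG IG) IG"
      "c = u + v"
      using c by (rule P2_idealE)
    have IG2: "ideal_prod ZG IG IG \<subseteq> carrier ZG"
      by (rule ZG.ideal_prod_in_carrier[OF ideal_aug_ideal ideal_aug_ideal])
    have u: "F u = \<one>\<^bsub>K\<^esub>"
      by (rule hom_ideal_prod_eq_one[OF F(1) grK IB_carrier IG_carrier F_IB_IG uv(1)])
    have v: "F v = \<one>\<^bsub>K\<^esub>"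
    proof (rule hom_ideal_prod_eq_one[OF F(1) grK IG2 IG_carrier _ uv(2)])
      fix i j assume ij: "i \<in> ideal_prod ZG IG IG" "j \<in> IG"
      show "F (i \<otimes>\<^bsub>ZG\<^esub> j) = \<one>\<^bsub>K\<^esub>"
        by (rule hom_ideal_prod_eq_one[OF hom_right_mult[OF F(1)] grK IG_carrier IG_carrier _ ij(1)])
          (use ij F_IG3 in \<open>auto simp: aug_ideal_iff\<close>)
    qed
    have "u \<in> IG" "v \<in> IG"
      using ideal_prod_subset_IG[OF IB_carrier uv(1)] ideal_prod_subset_IG[OF IG2 uv(2)] by auto
    then show ?thesis
      using u v by (simp add: uv(3) F_add)
  qed
  have "F \<in> hom FI K"
    using F(1) by (auto simp: hom_def aug_ideal_iff)
  then interpret F: group_hom FI K F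
    using comm_group_FI grK by (simp add: group_hom_def group_hom_axioms_def comm_group_def)
  have "J \<subseteq> kernel FI K F"
    using F_J P2_ideal_subset by (auto simp: kernel_def)
  then obtain h where "h \<in> hom (FI Mod J) K"
    "\<And>c. c \<in> carrier FI \<Longrightarrow> h (J #>\<^bsub>FI\<^esub> c) = F c"
    using F.FactGroup_universal_kernel[OF normal_P2_ideal] by blast
  then show thesis
    by (intro that[of h]) (auto simp: P_eq p2_def rho_eq F_delta)
qed

text \<open>
  The values of \<open>p\<^sub>2\<close> generate \<open>P\<^sub>2(G,B)\<close>.
\<close>

lemma P_generated:
  assumes "subgroup S P" "\<And>a. a \<in> carrier G \<Longrightarrow> p2 G B a \<in> S"
  shows "S = carrier P"
proof
  interpret S: subgroup S P by fact
  show "S \<subseteq> carrier P" by (rule S.subset)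
  have "c \<in> IG \<and> rho G B c \<in> S" if "c \<in> IG" for c
    using that
  proof (induction rule: aug_ideal_induct)
    case zero
    then show ?case using IG.zero_closed rho_zero[of 0] J.zero_closed by simp
  next
    case (of a)
    then show ?case using assms(2)[of a] by (auto simp: p2_def)
  next
    case (diff x y)
    have "x - y \<in> IG"
      using diff keys_diff[of x y] by (auto simp: aug_ideal_iff augmentation_diff)
    moreover from this have "rho G B x = rho G B (x - y) \<otimes>\<^bsub>P\<^esub> rho G B y"
      using diff rho_add[of "x - y" y] by simp
    ultimately show ?case
      using diff P.inv_solve_right[of "rho G B (x - y)" "rho G B x" "rho G B y"]
        S.m_closed[of "rho G B x" "inv\<^bsub>P\<^esub> rho G B y"] by simp
  qed
  then show "carrier P \<subseteq> S" by (auto simp: carrier_P)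
qed


section \<open>The tensor square of \<open>G/BG'\<close>\<close>

lemma normal_central_subgroup: "B \<lhd> G"
  unfolding normal_inv_iff
proof (intro conjI ballI)
  fix x h assume "x \<in> carrier G" "h \<in> B"
  moreover from this have "x \<otimes> h \<otimes> inv x = h"
    by (simp add: central[symmetric] m_assoc)
  ultimately show "x \<otimes> h \<otimes> inv x \<in> B" by simp
qed (rule subgroup_axioms)

lemma derived_carrier: "d \<in> derived G (carrier G) \<Longrightarrow> d \<in> carrier G"
  using derived_in_carrier[of "carrier G"] by blast

lemma normal_BG': "BG' G B \<lhd> G"
  unfolding normal_inv_iff
proof (intro conjI ballI)
  show "subgroup (BG' G B) G"
    unfolding BG'_def
    by (intro mult_norm_subgroup normal_central_subgroup normal_imp_subgroup[OF derived_self_is_normal])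
  fix x h assume x: "x \<in> carrier G" and "h \<in> BG' G B"
  then obtain b d where h: "b \<in> B" "d \<in> derived G (carrier G)" "h = b \<otimes> d"
    by (auto simp: BG'_def set_mult_def)
  have "x \<otimes> d \<otimes> inv x \<in> derived G (carrier G)"
    using derived_self_is_normal x h(2) by (simp add: normal_inv_iff)
  moreover have "x \<otimes> h \<otimes> inv x = b \<otimes> (x \<otimes> d \<otimes> inv x)"
    using x h(1) derived_carrier[OF h(2)] central[OF h(1) x] by (simp add: h(3) flip: m_assoc)
  ultimately show "x \<otimes> h \<otimes> inv x \<in> BG' G B"
    using h(1) by (auto simp: BG'_def set_mult_def)
qed

text \<open>
  The group \<open>G/BG'\<close>, its tensor square, and the elements \<open>bar a \<otimes> bar b\<close> of the latter.
\<close>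

abbreviation "Gb \<equiv> bar_group G B"
abbreviation "T \<equiv> bar_tensor_group G B"
abbreviation "bt \<equiv> bar_tensor G B"

sublocale BG': normal "BG' G B" G by (rule normal_BG')

sublocale Gb: group Gb unfolding bar_group_def by (rule BG'.factorgroup_is_group)

lemma carrier_bar_group: "carrier Gb = bar G B ` carrier G"
  by (simp add: bar_group_def carrier_FactGroup bar_def[abs_def])

lemma bar_mult: "a \<in> carrier G \<Longrightarrow> b \<in> carrier G \<Longrightarrow>
    bar G B (a \<otimes> b) = bar G B a \<otimes>\<^bsub>Gb\<^esub> bar G B b"
  by (simp add: bar_group_def bar_def BG'.rcos_sum)

lemma bar_closed [simp, intro]: "a \<in> carrier G \<Longrightarrow> bar G B a \<in> carrier Gb"
  unfolding carrier_bar_group by blast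

sublocale T: comm_group T by (rule comm_group_tensor_group) (rule Gb.group_axioms)+

lemma bar_tensor_closed [simp, intro]: "a \<in> carrier G \<Longrightarrow> b \<in> carrier G \<Longrightarrow> bt a b \<in> carrier T"
  unfolding bar_tensor_def by (intro tensor_elem_closed Gb.group_axioms bar_closed)

lemma bar_tensor_mult_left:
  "a \<in> carrier G \<Longrightarrow> a' \<in> carrier G \<Longrightarrow> b \<in> carrier G \<Longrightarrow> bt (a \<otimes> a') b = bt a b \<otimes>\<^bsub>T\<^esub> bt a' b"
  by (simp add: bar_tensor_def bar_mult tensor_elem_mult_left Gb.group_axioms)

lemma bar_tensor_mult_right:
  "a \<in> carrier G \<Longrightarrow> b \<in> carrier G \<Longrightarrow> b' \<in> carrier G \<Longrightarrow> bt a (b \<otimes> b') = bt a b \<otimes>\<^bsub>T\<^esub> bt a b'"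
  by (simp add: bar_tensor_def bar_mult tensor_elem_mult_right Gb.group_axioms)

lemma bar_tensor_left_hom: "b \<in> carrier G \<Longrightarrow> group_hom G T (\<lambda>a. bt a b)"
  by unfold_locales (simp add: hom_def bar_tensor_mult_left)

lemma bar_tensor_right_hom: "a \<in> carrier G \<Longrightarrow> group_hom G T (bt a)"
  by unfold_locales (simp add: hom_def bar_tensor_mult_right)

lemma bar_tensor_one [simp]: "a \<in> carrier G \<Longrightarrow> bt \<one> a = \<one>\<^bsub>T\<^esub>" "a \<in> carrier G \<Longrightarrow> bt a \<one> = \<one>\<^bsub>T\<^esub>"
  using group_hom.hom_one[OF bar_tensor_left_hom] group_hom.hom_one[OF bar_tensor_right_hom] by auto

lemma bar_tensor_inv_left: "a \<in> carrier G \<Longrightarrow> b \<in> carrier G \<Longrightarrow> bt (inv a) b = inv\<^bsub>T\<^esub> bt a b"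
  using group_hom.hom_inv[OF bar_tensor_left_hom] by auto

lemma hom_T_eqI:
  assumes "h \<in> hom T K" "h' \<in> hom T K" "group K"
    and "\<And>a b. a \<in> carrier G \<Longrightarrow> b \<in> carrier G \<Longrightarrow> h (bt a b) = h' (bt a b)"
    and "t \<in> carrier T"
  shows "h t = h' t"
  by (rule hom_tensor_group_eqI[OF Gb.group_axioms Gb.group_axioms assms(1-3) _ assms(5)])
    (use assms(4) in \<open>auto simp: carrier_bar_group bar_tensor_def\<close>)

text \<open>
  A homomorphism from \<open>G\<close> to an abelian group that is trivial on \<open>B\<close> is trivial on \<open>BG'\<close>,
  and so depends on cosets only.
\<close>

lemma hom_const_on_bar:
  assumes K: "comm_group K" and f: "f \<in> hom G K" and B: "\<And>b. b \<in> B \<Longrightarrow> f b = \<one>\<^bsub>K\<^esub>"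
    and a: "a \<in> carrier G" "a' \<in> carrier G" "bar G B a = bar G B a'"
  shows "f a = f a'"
proof -
  interpret K: comm_group K by fact
  interpret f: group_hom G K f
    using f by unfold_locales
  have "a' \<in> BG' G B #> a"
    using a rcos_self[OF a(2) BG'.subgroup_axioms] by (simp add: bar_def)
  then obtain b d where bd: "b \<in> B" "d \<in> derived G (carrier G)" "a' = b \<otimes> d \<otimes> a"
    by (auto simp: r_coset_def BG'_def set_mult_def)
  have "f d = \<one>\<^bsub>K\<^esub>" by (rule f.derived_imp_one[OF K bd(2)])
  then show ?thesis
    using bd derived_carrier[OF bd(2)] a by (simp add: B)
qed

text \<open>
  Bilinear maps on \<open>G\<close> with values in an abelian group that vanish on \<open>B\<close> in either argument
  factor through the tensor square of \<open>G/BG'\<close>.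
\<close>

lemma T_universal:
  assumes K: "comm_group K"
    and left: "\<And>b. b \<in> carrier G \<Longrightarrow> (\<lambda>a. f a b) \<in> hom G K"
    and right: "\<And>a. a \<in> carrier G \<Longrightarrow> f a \<in> hom G K"
    and B: "\<And>b g. b \<in> B \<Longrightarrow> g \<in> carrier G \<Longrightarrow> f b g = \<one>\<^bsub>K\<^esub>"
      "\<And>b g. b \<in> B \<Longrightarrow> g \<in> carrier G \<Longrightarrow> f g b = \<one>\<^bsub>K\<^esub>"
  obtains h where "h \<in> hom T K"
    "\<And>a b. a \<in> carrier G \<Longrightarrow> b \<in> carrier G \<Longrightarrow> h (bt a b) = f a b"
proof -
  interpret K: comm_group K by fact
  \<comment> \<open>A choice of representatives of the cosets in \<open>G/BG'\<close>.\<close>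
  define r where "r X = (SOME a. a \<in> carrier G \<and> bar G B a = X)" for X
  have r: "r X \<in> carrier G \<and> bar G B (r X) = X" if "X \<in> carrier Gb" for X
    unfolding r_def by (rule someI_ex) (use that in \<open>auto simp: carrier_bar_group\<close>)
  have f_closed: "f a b \<in> carrier K" if "a \<in> carrier G" "b \<in> carrier G" for a b
    using hom_in_carrier[OF right] that by blast
  have f_r: "f (r (bar G B a)) (r (bar G B b)) = f a b" if "a \<in> carrier G" "b \<in> carrier G" for a b
  proof -
    have ra: "r (bar G B a) \<in> carrier G" "bar G B (r (bar G B a)) = bar G B a"
      and rb: "r (bar G B b) \<in> carrier G" "bar G B (r (bar G B b)) = bar G B b"
      using that r bar_closed by auto
    have "f (r (bar G B a)) (r (bar G B b)) = f a (r (bar G B b))"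
      by (rule hom_const_on_bar[OF K left[OF rb(1)] _ ra(1) that(1) ra(2)]) (use B rb in auto)
    also have "\<dots> = f a b"
      by (rule hom_const_on_bar[OF K right[OF that(1)] _ rb(1) that(2) rb(2)]) (use B that in auto)
    finally show ?thesis .
  qed
  obtain h where h: "h \<in> hom T K"
    "\<And>x y. x \<in> carrier Gb \<Longrightarrow> y \<in> carrier Gb \<Longrightarrow> h (tensor_elem Gb Gb x y) = f (r x) (r y)"
  proof (rule tensor_group_universal[OF Gb.group_axioms Gb.group_axioms K,
        where f = "\<lambda>x y. f (r x) (r y)"])
    fix x y assume "x \<in> carrier Gb" "y \<in> carrier Gb"
    then show "f (r x) (r y) \<in> carrier K" using r f_closed by blast
  next
    fix x x' y assume "x \<in> carrier Gb" "x' \<in> carrier Gb" "y \<in> carrier Gb"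
    then obtain a a' b where ab: "a \<in> carrier G" "a' \<in> carrier G" "b \<in> carrier G"
      "x = bar G B a" "x' = bar G B a'" "y = bar G B b"
      by (auto simp: carrier_bar_group)
    then show "f (r (x \<otimes>\<^bsub>Gb\<^esub> x')) (r y) = f (r x) (r y) \<otimes>\<^bsub>K\<^esub> f (r x') (r y)"
      using hom_mult[OF left[of b], of a a'] by (simp add: f_r flip: bar_mult)
  next
    fix x y y' assume "x \<in> carrier Gb" "y \<in> carrier Gb" "y' \<in> carrier Gb"
    then obtain a b b' where ab: "a \<in> carrier G" "b \<in> carrier G" "b' \<in> carrier G"
      "x = bar G B a" "y = bar G B b" "y' = bar G B b'"
      by (auto simp: carrier_bar_group)
    then show "f (r x) (r (y \<otimes>\<^bsub>Gb\<^esub> y')) = f (r x) (r y) \<otimes>\<^bsub>K\<^esub> f (r x) (r y')"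
      using hom_mult[OF right[of a], of b b'] by (simp add: f_r flip: bar_mult)
  qed blast+
  show thesis
    by (rule that[OF h(1)]) (simp add: bar_tensor_def h(2) f_r)
qed

section \<open>The group \<open>Q(G,B)\<close>\<close>

abbreviation "QG \<equiv> Q G B"

lemma carrier_Q: "carrier QG = carrier T \<times> carrier G"
  and one_Q: "\<one>\<^bsub>QG\<^esub> = (\<one>\<^bsub>T\<^esub>, \<one>)"
  and mult_Q: "(x, a) \<otimes>\<^bsub>QG\<^esub> (y, b) = (x \<otimes>\<^bsub>T\<^esub> y \<otimes>\<^bsub>T\<^esub> inv\<^bsub>T\<^esub> bt a b, a \<otimes> b)"
  by (simp_all add: Q_def)

lemma group_Q: "group QG"
proof (rule groupI)
  fix u v assume "u \<in> carrier QG" "v \<in> carrier QG"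
  then show "u \<otimes>\<^bsub>QG\<^esub> v \<in> carrier QG"
    by (auto simp: carrier_Q mult_Q)
next
  fix u v w assume "u \<in> carrier QG" "v \<in> carrier QG" "w \<in> carrier QG"
  then show "u \<otimes>\<^bsub>QG\<^esub> v \<otimes>\<^bsub>QG\<^esub> w = u \<otimes>\<^bsub>QG\<^esub> (v \<otimes>\<^bsub>QG\<^esub> w)"
    by (auto simp: carrier_Q mult_Q m_assoc bar_tensor_mult_left bar_tensor_mult_right T.inv_mult T.m_ac)
next
  fix u assume "u \<in> carrier QG"
  then show "\<one>\<^bsub>QG\<^esub> \<otimes>\<^bsub>QG\<^esub> u = u"
    by (auto simp: carrier_Q mult_Q one_Q)
next
  fix u assume "u \<in> carrier QG"
  then obtain x a where u: "u = (x, a)" "x \<in> carrier T" "a \<in> carrier G"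
    by (auto simp: carrier_Q)
  then have "(inv\<^bsub>T\<^esub> (x \<otimes>\<^bsub>T\<^esub> bt a a), inv a) \<otimes>\<^bsub>QG\<^esub> u = \<one>\<^bsub>QG\<^esub>"
    by (simp add: mult_Q one_Q bar_tensor_inv_left T.m_assoc)
  moreover have "(inv\<^bsub>T\<^esub> (x \<otimes>\<^bsub>T\<^esub> bt a a), inv a) \<in> carrier QG"
    using u by (simp add: carrier_Q)
  ultimately show "\<exists>v\<in>carrier QG. v \<otimes>\<^bsub>QG\<^esub> u = \<one>\<^bsub>QG\<^esub>" by blast
qed (simp add: carrier_Q one_Q)

sublocale QG: group QG by (rule group_Q)

lemma q_closed [simp, intro]: "a \<in> carrier G \<Longrightarrow> q G B a \<in> carrier QG"
  by (simp add: q_def carrier_Q)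

lemma w_q_hom: "w_q G B \<in> hom T QG"
  by (rule homI) (simp_all add: w_q_def carrier_Q mult_Q)

lemma q_mult: "a \<in> carrier G \<Longrightarrow> b \<in> carrier G \<Longrightarrow>
    w_q G B (bt a b) \<otimes>\<^bsub>QG\<^esub> (q G B a \<otimes>\<^bsub>QG\<^esub> q G B b) = q G B (a \<otimes> b)"
  by (simp add: w_q_def q_def mult_Q)

lemma Q_decomp: "x \<in> carrier T \<Longrightarrow> a \<in> carrier G \<Longrightarrow> (x, a) = w_q G B x \<otimes>\<^bsub>QG\<^esub> q G B a"
  by (simp add: w_q_def q_def mult_Q)

text \<open>
  The values of \<open>q\<close> generate \<open>Q(G,B)\<close>: the elements \<open>w_q(a \<otimes> b)\<close> are \<open>q(ab) - (q(a) + q(b))\<close>.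
\<close>

lemma hom_Q_eqI:
  assumes "h \<in> hom QG K" "h' \<in> hom QG K" "group K"
    and q: "\<And>a. a \<in> carrier G \<Longrightarrow> h (q G B a) = h' (q G B a)"
    and "z \<in> carrier QG"
  shows "h z = h' z"
proof -
  interpret h: group_hom QG K h
    using assms by (simp add: group_hom_def group_hom_axioms_def group_Q)
  interpret h': group_hom QG K h'
    using assms by (simp add: group_hom_def group_hom_axioms_def group_Q)
  note w_closed = hom_in_carrier[OF w_q_hom]
  have w: "h (w_q G B x) = h' (w_q G B x)" if "x \<in> carrier T" for x
  proof -
    have "(h \<circ> w_q G B) x = (h' \<circ> w_q G B) x"
    proof (rule hom_T_eqI[OF Group.hom_compose[OF w_q_hom assms(1)] Group.hom_compose[OF w_q_hom assms(2)]
          assms(3) _ that])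
      fix a b assume ab: "a \<in> carrier G" "b \<in> carrier G"
      let ?c = "q G B a \<otimes>\<^bsub>QG\<^esub> q G B b"
      have "h (w_q G B (bt a b)) \<otimes>\<^bsub>K\<^esub> h ?c = h' (w_q G B (bt a b)) \<otimes>\<^bsub>K\<^esub> h' ?c"
        using q[of "a \<otimes> b"] ab w_closed by (simp flip: h.hom_mult h'.hom_mult add: q_mult)
      moreover have "h ?c = h' ?c" using ab q by simp
      ultimately show "(h \<circ> w_q G B) (bt a b) = (h' \<circ> w_q G B) (bt a b)"
        using ab w_closed by (simp add: h.H.right_cancel)
    qed
    then show ?thesis by simp
  qed
  obtain x a where "z = (x, a)" "x \<in> carrier T" "a \<in> carrier G"
    using assms(5) by (auto simp: carrier_Q)
  then show ?thesis using w_closed q w by (simp add: Q_decomp)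
qed

text \<open>
  The description that defines \<open>\<mu>\<^sub>2\<close> has exactly one solution.
\<close>

lemma mu2_hom: "mu2 G B \<in> hom T P"
  and mu2_bar_tensor: "a \<in> carrier G \<Longrightarrow> b \<in> carrier G \<Longrightarrow>
    mu2 G B (bt a b) = p2 G B a \<otimes>\<^bsub>P2 G B\<^esub> p2 G B b"
proof -
  let ?C = "\<lambda>h. h \<in> hom T P \<and> h \<in> extensional (carrier T) \<and>
    (\<forall>a\<in>carrier G. \<forall>b\<in>carrier G. h (bt a b) = p2 G B a \<otimes>\<^bsub>P2 G B\<^esub> p2 G B b)"
  obtain h where h: "h \<in> hom T P"
    "\<And>a b. a \<in> carrier G \<Longrightarrow> b \<in> carrier G \<Longrightarrow> h (bt a b) = p2 G B a \<otimes>\<^bsub>P2 G B\<^esub> p2 G B b"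
    by (rule T_universal[OF comm_group_P, of "\<lambda>a b. p2 G B a \<otimes>\<^bsub>P2 G B\<^esub> p2 G B b"])
      (auto simp: hom_def p2_prod_closed p2_prod_mult_left p2_prod_mult_right p2_prod_central)
  have "?C (restrict h (carrier T))"
    using h by (auto simp: hom_def)
  moreover have "h = h'" if "?C h" "?C h'" for h h'
    by (rule extensionalityI[of _ "carrier T"]) (use that hom_T_eqI[of h P h'] P.group_axioms in auto)
  ultimately have "\<exists>!h. ?C h" by (intro ex_ex1I exI)
  from theI'[OF this] have "?C (mu2 G B)" by (simp add: mu2_def P_def)
  then show "mu2 G B \<in> hom T P"
    "a \<in> carrier G \<Longrightarrow> b \<in> carrier G \<Longrightarrow> mu2 G B (bt a b) = p2 G B a \<otimes>\<^bsub>P2 G B\<^esub> p2 G B b"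
    by auto
qed

end

section \<open>The isomorphism\<close>

text \<open>
  The homomorphism \<open>Q(G,B) \<rightarrow> P\<^sub>2(G,B)\<close> through which \<open>p\<^sub>2\<close> factors by the universal property
  of \<open>q\<close>, given by \<open>(x, a) \<mapsto> \<mu>\<^sub>2(x) + p\<^sub>2(a)\<close>.
\<close>

definition Q_to_P2 :: "('a, 'm) monoid_scheme \<Rightarrow> 'a set \<Rightarrow> 'a quad \<Rightarrow> ('a \<Rightarrow>\<^sub>0 int) set" where
  "Q_to_P2 G B = (\<lambda>(x, a). mu2 G B x \<otimes>\<^bsub>add_monoid (P2 G B)\<^esub> p2 G B a)"

text \<open>
  The map that it induces on the abelianization: on a coset \<open>X\<close> of the commutator subgroup
  the homomorphism is constant, and its value is the only element of the image of \<open>X\<close>.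
\<close>

definition Qab_to_P2 :: "('a, 'm) monoid_scheme \<Rightarrow> 'a set \<Rightarrow> 'a quad set \<Rightarrow> ('a \<Rightarrow>\<^sub>0 int) set" where
  "Qab_to_P2 G B X = the_elem (Q_to_P2 G B ` X)"

context central_subgroup
begin

lemma Q_to_P2_eq: "Q_to_P2 G B (x, a) = mu2 G B x \<otimes>\<^bsub>P\<^esub> p2 G B a"
  by (simp add: Q_to_P2_def P_def)

lemma mu2_closed [simp, intro]: "x \<in> carrier T \<Longrightarrow> mu2 G B x \<in> carrier P"
  by (rule hom_in_carrier[OF mu2_hom])

sublocale mu2: group_hom T P "mu2 G B"
  by unfold_locales (rule mu2_hom)

lemma p2_one [simp]: "p2 G B \<one> = \<one>\<^bsub>P\<^esub>"
  using rho_zero[of 0] J.zero_closed by (simp add: p2_def)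

lemma Q_to_P2_hom: "Q_to_P2 G B \<in> hom QG P"
proof (rule homI)
  show "Q_to_P2 G B z \<in> carrier P" if "z \<in> carrier QG" for z
    using that by (auto simp: carrier_Q Q_to_P2_eq)
  fix z z' assume "z \<in> carrier QG" "z' \<in> carrier QG"
  then obtain x a y b where *: "z = (x, a)" "z' = (y, b)" "x \<in> carrier T" "y \<in> carrier T"
    "a \<in> carrier G" "b \<in> carrier G"
    by (auto simp: carrier_Q)
  let ?e = "p2 G B a \<otimes>\<^bsub>P2 G B\<^esub> p2 G B b"
  note p2_prod_closed[OF *(5,6), simp]
  have "Q_to_P2 G B (z \<otimes>\<^bsub>QG\<^esub> z') =
      mu2 G B x \<otimes>\<^bsub>P\<^esub> mu2 G B y \<otimes>\<^bsub>P\<^esub> inv\<^bsub>P\<^esub> ?e \<otimes>\<^bsub>P\<^esub> (p2 G B a \<otimes>\<^bsub>P\<^esub> p2 G B b \<otimes>\<^bsub>P\<^esub> ?e)"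
    using * by (simp add: mult_Q Q_to_P2_eq p2_mult mu2_bar_tensor)
  also have "\<dots> = (mu2 G B x \<otimes>\<^bsub>P\<^esub> mu2 G B y) \<otimes>\<^bsub>P\<^esub> (p2 G B a \<otimes>\<^bsub>P\<^esub> p2 G B b) \<otimes>\<^bsub>P\<^esub> (inv\<^bsub>P\<^esub> ?e \<otimes>\<^bsub>P\<^esub> ?e)"
    using * by (simp add: P.m_ac del: P.l_inv P.r_inv)
  also have "\<dots> = (mu2 G B x \<otimes>\<^bsub>P\<^esub> p2 G B a) \<otimes>\<^bsub>P\<^esub> (mu2 G B y \<otimes>\<^bsub>P\<^esub> p2 G B b)"
    using * by (simp add: P.l_inv) (simp add: P.m_ac)
  finally show "Q_to_P2 G B (z \<otimes>\<^bsub>QG\<^esub> z') = Q_to_P2 G B z \<otimes>\<^bsub>P\<^esub> Q_to_P2 G B z'"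
    using * by (simp add: Q_to_P2_eq)
qed

sublocale Q_to_P2: group_hom QG P "Q_to_P2 G B"
  by unfold_locales (rule Q_to_P2_hom)

lemma Q_to_P2_q [simp]: "a \<in> carrier G \<Longrightarrow> Q_to_P2 G B (q G B a) = p2 G B a"
  by (simp add: q_def Q_to_P2_eq)

lemma Q_to_P2_w_q: "x \<in> carrier T \<Longrightarrow> Q_to_P2 G B (w_q G B x) = mu2 G B x"
  by (simp add: w_q_def Q_to_P2_eq)

lemma Q_to_P2_surj: "Q_to_P2 G B ` carrier QG = carrier P"
  by (rule P_generated[OF Q_to_P2.img_is_subgroup]) (metis Q_to_P2_q imageI q_closed)

text \<open>
  The commutator subgroup of \<open>Q(G,B)\<close>.
\<close>

abbreviation "DQ \<equiv> derived QG (carrier QG)"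

lemma comm_group_Qab: "comm_group (abelianization QG)"
  unfolding abelianization_def by (rule QG.derived_quot_is_comm_group)

lemma ab_hom: "ab QG \<in> hom QG (abelianization QG)"
  using normal.r_coset_hom_Mod[OF QG.derived_self_is_normal]
  by (simp add: abelianization_def ab_def[abs_def])

lemma w_q_closed: "x \<in> carrier T \<Longrightarrow> w_q G B x \<in> carrier QG"
  by (rule hom_in_carrier[OF w_q_hom])

text \<open>
  The inverse of the isomorphism: the map \<open>ab \<circ> q\<close> is quadratic relative \<open>B\<close>.
\<close>

lemma P2_to_Qab:
  obtains h where "h \<in> hom P (abelianization QG)"
    "\<And>a. a \<in> carrier G \<Longrightarrow> h (p2 G B a) = ab QG (q G B a)"
proof -
  interpret A: comm_group "abelianization QG" by (rule comm_group_Qab)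
  interpret ab: group_hom QG "abelianization QG" "ab QG"
    by unfold_locales (rule ab_hom)
  have bar_tensor_central: "bt b g = \<one>\<^bsub>T\<^esub>" if "b \<in> B" "g \<in> carrier G" for b g
  proof -
    have "BG' G B #> b = BG' G B"
      using that derived_is_subgroup[of "carrier G", THEN subgroup.one_closed]
      by (intro coset_join2 BG'.subgroup_axioms) (auto simp: BG'_def set_mult_def, force)
    then have "bar G B b = bar G B \<one>"
      using BG'.subset by (simp add: bar_def)
    then show ?thesis
      using that bar_tensor_one(1)[of g] by (simp add: bar_tensor_def)
  qed
  show thesis
  proof (rule P2_universal[OF comm_group_Qab, of "\<lambda>a. ab QG (q G B a)" "\<lambda>a b. ab QG (w_q G B (bt a b))"])
    fix a b assume ab: "a \<in> carrier G" "b \<in> carrier G"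
    show "ab QG (q G B (a \<otimes> b)) = ab QG (q G B a) \<otimes>\<^bsub>abelianization QG\<^esub> ab QG (q G B b)
        \<otimes>\<^bsub>abelianization QG\<^esub> ab QG (w_q G B (bt a b))"
      using ab w_q_closed by (simp add: A.m_comm flip: q_mult)
  next
    fix a a' b assume "a \<in> carrier G" "a' \<in> carrier G" "b \<in> carrier G"
    then show "ab QG (w_q G B (bt (a \<otimes> a') b)) =
        ab QG (w_q G B (bt a b)) \<otimes>\<^bsub>abelianization QG\<^esub> ab QG (w_q G B (bt a' b))"
      using w_q_closed by (simp add: bar_tensor_mult_left hom_mult[OF w_q_hom])
  next
    fix b g assume "b \<in> B" "g \<in> carrier G"
    then show "ab QG (w_q G B (bt b g)) = \<one>\<^bsub>abelianization QG\<^esub>"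
      using ab.hom_one by (simp add: bar_tensor_central w_q_def one_Q)
  qed (use that w_q_closed in auto)
qed

text \<open>
  The composite of the two maps \<open>Q(G,B) \<rightarrow> P\<^sub>2(G,B) \<rightarrow> Q(G,B)\<^sup>a\<^sup>b\<close> agrees with \<open>ab\<close> on the values
  of \<open>q\<close>, hence everywhere, so only commutators can be killed by the first map.
\<close>

lemma kernel_Q_to_P2: "kernel QG P (Q_to_P2 G B) = DQ"
proof
  show "DQ \<subseteq> kernel QG P (Q_to_P2 G B)"
    using Q_to_P2.derived_imp_one[OF comm_group_P] QG.derived_in_carrier[of "carrier QG"]
    by (auto simp: kernel_def)
  obtain h where h: "h \<in> hom P (abelianization QG)"
    "\<And>a. a \<in> carrier G \<Longrightarrow> h (p2 G B a) = ab QG (q G B a)"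
    by (rule P2_to_Qab) blast
  interpret A: comm_group "abelianization QG" by (rule comm_group_Qab)
  interpret h: group_hom P "abelianization QG" h
    by unfold_locales (rule h(1))
  show "kernel QG P (Q_to_P2 G B) \<subseteq> DQ"
  proof
    fix z assume z: "z \<in> kernel QG P (Q_to_P2 G B)"
    then have zQ: "z \<in> carrier QG" by (simp add: kernel_def)
    have "ab QG z = (h \<circ> Q_to_P2 G B) z"
      by (rule hom_Q_eqI[OF ab_hom Group.hom_compose[OF Q_to_P2_hom h(1)] A.group_axioms _ zQ])
        (simp add: h(2))
    also have "\<dots> = \<one>\<^bsub>abelianization QG\<^esub>"
      using z h.hom_one by (simp add: kernel_def)
    also have "\<dots> = DQ" by (simp add: abelianization_def)
    finally show "z \<in> DQ"
      using QG.coset_join1[of DQ z] zQ QG.derived_is_subgroup[of "carrier QG"] by (simp add: ab_def)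
  qed
qed

lemma Qab_to_P2_iso: "Qab_to_P2 G B \<in> iso (abelianization QG) P"
  using Q_to_P2.FactGroup_iso_set[OF Q_to_P2_surj]
  by (simp add: kernel_Q_to_P2 abelianization_def Qab_to_P2_def[abs_def])

lemma Qab_to_P2_ab:
  assumes "z \<in> carrier QG"
  shows "Qab_to_P2 G B (ab QG z) = Q_to_P2 G B z"
proof -
  have "Q_to_P2 G B (d \<otimes>\<^bsub>QG\<^esub> z) = Q_to_P2 G B z" if "d \<in> DQ" for d
    using assms Q_to_P2.derived_imp_one[OF comm_group_P that] subsetD[OF QG.derived_in_carrier that]
    by simp
  moreover have "\<one>\<^bsub>QG\<^esub> \<in> DQ"
    using QG.derived_is_subgroup[of "carrier QG"] by (simp add: subgroup.one_closed)
  ultimately have "Q_to_P2 G B ` ab QG z = {Q_to_P2 G B z}"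
    by (auto simp: ab_def r_coset_def image_UN)
  then show ?thesis by (simp add: Qab_to_P2_def)
qed

end

section \<open>Naturality\<close>

lemma tensor_map_hom:
  assumes "group A" "group B" "group C" "group D" and g: "g \<in> hom A C" and h: "h \<in> hom B D"
  shows "tensor_map C D g h \<in> hom (tensor_group A B) (tensor_group C D)"
    and "x \<in> carrier A \<Longrightarrow> y \<in> carrier B \<Longrightarrow>
      tensor_map C D g h (tensor_elem A B x y) = tensor_elem C D (g x) (h y)"
proof -
  let ?F = "free_Abelian_group (carrier A \<times> carrier B)"
  let ?F' = "free_Abelian_group (carrier C \<times> carrier D)"
  let ?e = "frag_extend (\<lambda>(x, y). frag_of (g x, h y))"
  note closed = hom_in_carrier[OF g] hom_in_carrier[OF h]
  have "?e \<in> hom ?F ?F'"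
  proof (rule homI)
    fix c assume "c \<in> carrier ?F"
    then have "Poly_Mapping.keys (?e c) \<subseteq> carrier C \<times> carrier D"
      using keys_frag_extend[of "\<lambda>(x, y). frag_of (g x, h y)" c] closed by fastforce
    then show "?e c \<in> carrier ?F'" by simp
  qed (simp add: frag_extend_add)
  then interpret e: group_hom ?F ?F' ?e
    by (simp add: group_hom_def group_hom_axioms_def)
  have "?e s \<in> tensor_relations C D" if "s \<in> tensor_relations A B" for s
    using that unfolding tensor_relations_def[of A B]
  proof (elim UnE CollectE exE conjE)
    fix x x' y
    assume "s = frag_of (x \<otimes>\<^bsub>A\<^esub> x', y) - frag_of (x, y) - frag_of (x', y)"
      and *: "x \<in> carrier A" "x' \<in> carrier A" "y \<in> carrier B"
    then have "?e s = frag_of (g x \<otimes>\<^bsub>C\<^esub> g x', h y) - frag_of (g x, h y) - frag_of (g x', h y)"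
      by (simp add: frag_extend_diff hom_mult[OF g])
    then show ?thesis
      using closed * unfolding tensor_relations_def by blast
  next
    fix x y y'
    assume "s = frag_of (x, y \<otimes>\<^bsub>B\<^esub> y') - frag_of (x, y) - frag_of (x, y')"
      and *: "x \<in> carrier A" "y \<in> carrier B" "y' \<in> carrier B"
    then have "?e s = frag_of (g x, h y \<otimes>\<^bsub>D\<^esub> h y') - frag_of (g x, h y) - frag_of (g x, h y')"
      by (simp add: frag_extend_diff hom_mult[OF h])
    then show ?thesis
      using closed * unfolding tensor_relations_def by blast
  qed
  then have "?e ` tensor_relations A B \<subseteq> tensor_relations C D"
    by blast
  then have kernel: "?e ` tensor_kernel A B \<subseteq> tensor_kernel C D"
    unfolding tensor_kernel_def
    by (simp add: e.generate_img[symmetric] tensor_relations_carrier assms e.H.mono_generate)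
  note induced = e.group_hom_axioms tensor_kernel_normal[OF assms(1,2)]
    tensor_kernel_normal[OF assms(3,4)] kernel
  show "tensor_map C D g h \<in> hom (tensor_group A B) (tensor_group C D)"
    using induced_map_hom[OF induced] by (simp add: tensor_map_def[abs_def] tensor_group_def)
  show "tensor_map C D g h (tensor_elem A B x y) = tensor_elem C D (g x) (h y)"
    if "x \<in> carrier A" "y \<in> carrier B"
    using induced_map_coset[OF induced, of "frag_of (x, y)"] that
    by (simp add: tensor_map_def tensor_elem_def)
qed

lemma frag_extend_group_ring_mult:
  assumes "f \<in> hom G H" "Poly_Mapping.keys c \<subseteq> carrier G" "Poly_Mapping.keys d \<subseteq> carrier G"
  shows "frag_extend (frag_of \<circ> f) (c \<otimes>\<^bsub>group_ring G\<^esub> d) =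
    frag_extend (frag_of \<circ> f) c \<otimes>\<^bsub>group_ring H\<^esub> frag_extend (frag_of \<circ> f) d"
proof (rule free_Abelian_group_induct[OF assms(2)])
  fix x assume x: "x \<in> carrier G"
  show "frag_extend (frag_of \<circ> f) (frag_of x \<otimes>\<^bsub>group_ring G\<^esub> d) =
    frag_extend (frag_of \<circ> f) (frag_of x) \<otimes>\<^bsub>group_ring H\<^esub> frag_extend (frag_of \<circ> f) d"
    by (rule free_Abelian_group_induct[OF assms(3)])
      (use x in \<open>simp_all add: group_ring_mult_diff frag_extend_diff hom_mult[OF assms(1)]\<close>)
qed (simp_all add: group_ring_mult_diff frag_extend_diff)

lemma augmentation_frag_extend: "augmentation (frag_extend (frag_of \<circ> f) c) = augmentation c"
  by (rule free_Abelian_group_induct[of c UNIV]) (simp_all add: frag_extend_diff augmentation_diff)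

text \<open>
  A homomorphism of groups that takes one central subgroup into the other.
\<close>

locale central_subgroup_hom =
  G: central_subgroup B G + H: central_subgroup C H
  for B and G :: "('a, 'm) monoid_scheme" and C and H :: "('b, 'n) monoid_scheme" +
  fixes f :: "'a \<Rightarrow> 'b"
  assumes f_hom: "f \<in> hom G H" and f_sub: "f ` B \<subseteq> C"
begin

sublocale f: group_hom G H f
  by unfold_locales (rule f_hom)

lemma f_BG': "f ` BG' G B \<subseteq> BG' H C"
proof -
  have "f ` derived G (carrier G) \<subseteq> derived H (carrier H)"
    using f.derived_img[of "carrier G"] H.mono_derived[of "f ` carrier G" "carrier H"]
      f.img_is_subgroup[THEN subgroup.subset] by simp
  then have "f (b \<otimes>\<^bsub>G\<^esub> d) \<in> BG' H C" if "b \<in> B" "d \<in> derived G (carrier G)" for b d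
    using that f_sub G.derived_carrier[OF that(2)] by (auto simp: BG'_def set_mult_def)
  then show ?thesis by (auto simp: BG'_def set_mult_def)
qed

text \<open>
  The homomorphism that \<open>f\<close> induces on \<open>G/BG'\<close>; likewise \<open>ft\<close> on the tensor square and \<open>fz\<close> on
  the group rings.
\<close>

abbreviation "fb \<equiv> induced_map H (BG' H C) f"

lemma fb_hom: "fb \<in> hom G.Gb H.Gb"
  using induced_map_hom[OF f.group_hom_axioms G.normal_BG' H.normal_BG' f_BG']
  by (simp add: bar_group_def)

lemma fb_bar: "a \<in> carrier G \<Longrightarrow> fb (bar G B a) = bar H C (f a)"
  using induced_map_coset[OF f.group_hom_axioms G.normal_BG' H.normal_BG' f_BG']
  by (simp add: bar_def)

abbreviation "ft \<equiv> tensor_map H.Gb H.Gb fb fb"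

lemma ft_hom: "ft \<in> hom G.T H.T"
  by (intro tensor_map_hom fb_hom G.Gb.group_axioms H.Gb.group_axioms)

lemma ft_bar_tensor: "a \<in> carrier G \<Longrightarrow> b \<in> carrier G \<Longrightarrow> ft (G.bt a b) = H.bt (f a) (f b)"
  by (simp add: bar_tensor_def tensor_map_hom(2) fb_hom fb_bar G.Gb.group_axioms H.Gb.group_axioms)

sublocale ft: group_hom G.T H.T ft
  by unfold_locales (rule ft_hom)

lemma Q_map_hom: "Q_map H C f \<in> hom G.QG H.QG"
  by (rule homI) (auto simp: Q_map_def G.carrier_Q H.carrier_Q G.mult_Q H.mult_Q ft_bar_tensor)

lemma Q_map_q: "Q_map H C f (q G B a) = q H C (f a)"
  by (simp add: Q_map_def q_def)

lemma Qab_map_ab: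
  assumes "z \<in> carrier G.QG"
  shows "Qab_map H C f (ab G.QG z) = ab H.QG (Q_map H C f z)"
proof -
  interpret F: group_hom G.QG H.QG "Q_map H C f"
    by unfold_locales (rule Q_map_hom)
  have "Q_map H C f ` G.DQ \<subseteq> H.DQ"
    using F.derived_img[of "carrier G.QG"] H.QG.mono_derived[of "Q_map H C f ` carrier G.QG" "carrier H.QG"]
      F.img_is_subgroup[THEN subgroup.subset] by simp
  then show ?thesis
    using induced_map_coset[OF F.group_hom_axioms G.QG.derived_self_is_normal
        H.QG.derived_self_is_normal _ assms]
    by (simp add: Qab_map_def ab_def)
qed

abbreviation "fz \<equiv> frag_extend (frag_of \<circ> f)"

lemma fz_keys: "Poly_Mapping.keys c \<subseteq> S \<Longrightarrow> Poly_Mapping.keys (fz c) \<subseteq> f ` S"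
  using keys_frag_extend[of "frag_of \<circ> f" c] by fastforce

lemma fz_IG: "c \<in> G.IG \<Longrightarrow> fz c \<in> H.IG"
  using fz_keys[of c "carrier G"] f.img_is_subgroup[THEN subgroup.subset]
  by (auto simp: aug_ideal_iff augmentation_frag_extend)

lemma fz_IB: "c \<in> G.IB \<Longrightarrow> fz c \<in> H.IB"
  using fz_keys[of c B] f_sub by (auto simp: aug_ideal_iff augmentation_frag_extend)

lemma fz_ideal_prod:
  assumes "u \<in> ideal_prod G.ZG X Y" "X \<subseteq> carrier G.ZG" "Y \<subseteq> carrier G.ZG"
    and "\<And>c. c \<in> X \<Longrightarrow> fz c \<in> X'" "\<And>c. c \<in> Y \<Longrightarrow> fz c \<in> Y'"
  shows "fz u \<in> ideal_prod H.ZG X' Y'"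
  using assms(1)
proof induction
  case (prod i j)
  then have "fz (i \<otimes>\<^bsub>G.ZG\<^esub> j) = fz i \<otimes>\<^bsub>H.ZG\<^esub> fz j"
    using assms(2,3) carrier_group_ring by (intro frag_extend_group_ring_mult f_hom) blast+
  then show ?case
    using ideal_prod.prod[OF assms(4)[OF prod(1)] assms(5)[OF prod(2)], of H.ZG] by (simp only:)
next
  case (sum s t)
  then show ?case
    using ideal_prod.sum[of "fz s" H.ZG X' Y' "fz t"]
    by (simp only: add_group_ring frag_extend_add)
qed

lemma fz_P2_ideal: "c \<in> G.J \<Longrightarrow> fz c \<in> H.J"
proof -
  assume "c \<in> G.J"
  then obtain u v where uv: "u \<in> ideal_prod G.ZG G.IB G.IG"
    "v \<in> ideal_prod G.ZG (ideal_prod G.ZG G.IG G.IG) G.IG" "c = u + v"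
    by (rule P2_idealE)
  note IG = G.IG.a_subset
  have "fz u \<in> ideal_prod H.ZG H.IB H.IG"
    using G.aug_ideal_subgroup_subset IG by (intro fz_ideal_prod[OF uv(1)] fz_IB fz_IG) auto
  moreover have "fz v \<in> ideal_prod H.ZG (ideal_prod H.ZG H.IG H.IG) H.IG"
    using G.ZG.ideal_prod_in_carrier[OF G.ideal_aug_ideal G.ideal_aug_ideal]
    by (intro fz_ideal_prod[OF uv(2)] fz_ideal_prod[OF _ IG IG] fz_IG IG) auto
  ultimately show ?thesis
    by (auto simp: P2_ideal_def set_add_def' uv(3) frag_extend_add)
qed

text \<open>
  The induced map may be computed in the augmentation ideal instead of the group ring.
\<close>

lemma P2_map_eq: "P2_map H C f = induced_map H.FI H.J fz"
  by (simp add: P2_map_def induced_map_def[abs_def] set_mult_def group_ring_def free_Abelian_group_def)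

lemma fz_hom: "group_hom G.FI H.FI fz"
  using G.comm_group_FI H.comm_group_FI
  by (auto simp: group_hom_def group_hom_axioms_def comm_group_def hom_def fz_IG frag_extend_add)

lemma P2_map_hom: "P2_map H C f \<in> hom G.P H.P"
  unfolding P2_map_eq G.P_eq H.P_eq
  by (rule induced_map_hom[OF fz_hom G.normal_P2_ideal H.normal_P2_ideal]) (auto simp: fz_P2_ideal)

lemma P2_map_p2: "a \<in> carrier G \<Longrightarrow> P2_map H C f (p2 G B a) = p2 H C (f a)"
  unfolding P2_map_eq p2_def G.rho_eq H.rho_eq
  by (subst induced_map_coset[OF fz_hom G.normal_P2_ideal H.normal_P2_ideal])
    (auto simp: fz_P2_ideal frag_extend_diff)

text \<open>
  Both composites are homomorphisms that take \<open>q(a)\<close> to \<open>p\<^sub>2(f(a))\<close>.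
\<close>

lemma Q_to_P2_natural:
  assumes "z \<in> carrier G.QG"
  shows "Q_to_P2 H C (Q_map H C f z) = P2_map H C f (Q_to_P2 G B z)"
proof -
  have "(Q_to_P2 H C \<circ> Q_map H C f) z = (P2_map H C f \<circ> Q_to_P2 G B) z"
    by (rule G.hom_Q_eqI[OF Group.hom_compose[OF Q_map_hom H.Q_to_P2_hom]
          Group.hom_compose[OF G.Q_to_P2_hom P2_map_hom] H.P.group_axioms _ assms])
      (simp add: Q_map_q P2_map_p2)
  then show ?thesis by simp
qed

lemma Qab_to_P2_natural:
  assumes "X \<in> carrier (abelianization G.QG)"
  shows "Qab_to_P2 H C (Qab_map H C f X) = P2_map H C f (Qab_to_P2 G B X)"
proof -
  obtain z where z: "z \<in> carrier G.QG" "X = ab G.QG z"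
    using assms by (auto simp: abelianization_def carrier_FactGroup ab_def)
  then show ?thesis
    using hom_in_carrier[OF Q_map_hom z(1)]
    by (simp add: Qab_map_ab G.Qab_to_P2_ab H.Qab_to_P2_ab Q_to_P2_natural)
qed

end

lemma central_pair_imp_central_subgroup: "central_pair G B \<Longrightarrow> central_subgroup B G"
  unfolding central_pair_def central_subgroup_def central_subgroup_axioms_def by blast

lemma natural_between_Qab_to_P2: "natural_between Qab_to_P2 Qab_to_P2"
  unfolding natural_between_def
proof (intro allI impI ballI)
  fix G :: "'a monoid" and B and H :: "'b monoid" and C f X
  assume pairs: "central_pair G B" "central_pair H C" and f: "f \<in> pair_hom G B H C"
    and X: "X \<in> carrier (abelianization (Q G B))"
  interpret central_subgroup_hom B G C H f
    using pairs[THEN central_pair_imp_central_subgroup] f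
    by (simp add: central_subgroup_hom_def central_subgroup_hom_axioms_def pair_hom_def)
  show "Qab_to_P2 H C (Qab_map H C f X) = P2_map H C f (Qab_to_P2 G B X)"
    by (rule Qab_to_P2_natural[OF X])
qed

lemma Qab_to_P2_properties:
  assumes "central_pair G B"
  shows "Qab_to_P2 G B \<in> iso (abelianization (Q G B)) (add_monoid (P2 G B)) \<and>
    (\<forall>a\<in>carrier G. Qab_to_P2 G B (ab (Q G B) (q G B a)) = p2 G B a) \<and>
    (\<forall>x\<in>carrier (bar_tensor_group G B). Qab_to_P2 G B (ab (Q G B) (w_q G B x)) = mu2 G B x)"
proof -
  interpret central_subgroup B G by (rule central_pair_imp_central_subgroup[OF assms])
  show ?thesis
    using Qab_to_P2_iso by (simp add: P_def Qab_to_P2_ab w_q_closed Q_to_P2_w_q)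
qed

theorem proposition2p9:
  shows "\<exists>(\<alpha> :: 'a QP_family) (\<beta> :: 'b QP_family).
    (\<forall>G B. central_pair G B \<longrightarrow>
       \<alpha> G B \<in> iso (abelianization (Q G B)) (add_monoid (P2 G B)) \<and>
       (\<forall>a\<in>carrier G. \<alpha> G B (ab (Q G B) (q G B a)) = p2 G B a) \<and>
       (\<forall>x\<in>carrier (bar_tensor_group G B). \<alpha> G B (ab (Q G B) (w_q G B x)) = mu2 G B x)) \<and>
    (\<forall>H C. central_pair H C \<longrightarrow>
       \<beta> H C \<in> iso (abelianization (Q H C)) (add_monoid (P2 H C)) \<and>
       (\<forall>a\<in>carrier H. \<beta> H C (ab (Q H C) (q H C a)) = p2 H C a) \<and>
       (\<forall>x\<in>carrier (bar_tensor_group H C). \<beta> H C (ab (Q H C) (w_q H C x)) = mu2 H C x)) \<and>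
    natural_between \<alpha> \<alpha> \<and> natural_between \<alpha> \<beta> \<and>
    natural_between \<beta> \<alpha> \<and> natural_between \<beta> \<beta>"
  \<comment> \<open>The same construction serves for both carrier types.\<close>
  by (rule exI[of _ Qab_to_P2], rule exI[of _ Qab_to_P2])
    (intro conjI allI impI natural_between_Qab_to_P2 Qab_to_P2_properties)

end
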